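(* Let $X,Y,Z$ be real Hilbert spaces and let $\pi:X\to Z$ be a continuous linear operator. Limit data: let $A:X\to X$ be $(m_A,L_A)$-strongly monotone Lipschitz, let $\mathcal S:C(\mathbb R_+;X)\to C(\mathbb R_+;X)$ be history-dependent with constants $(s_m)_{m\in\mathbb N}$, let $b:X\times Y\to\mathbb R$ be an $(M_b,\alpha_b)$-inf-sup bilinear form, let $\Lambda\subset Y$ be closed and convex with $0_Y\in\Lambda$, and let $f\in C(\mathbb R_+;Z)$, $h\in C(\mathbb R_+;X)$. Approximating data: for each $n\in\mathbb N$ let $A_n:X\to X$ be $(m_n,L_n)$-strongly monotone Lipschitz, let $\mathcal S_n:C(\mathbb R_+;X)\to C(\mathbb R_+;X)$ be history-dependent with constants $(s_m^n)_{m\in\mathbb N}$, let $b_n:X\times Y\to\mathbb R$ be an $(M_n,\alpha_n)$-inf-sup bilinear form, let $\Lambda_n\subset Y$ be closed and convex with $0_Y\in\Lambda_n$, and let $f_n\in C(\mathbb R_+;Z)$, $h_n\in C(\mathbb R_+;X)$. Assume: (1) for each $n$ there are $F_n\ge0$, $\delta_n\ge0$ with $\|A_nv-Av\|_X\le F_n(\|v\|_X+\delta_n)$ for all $v\in X$; moreover $F_n\to0$ and $\{\delta_n\}$ is bounded; (2) there are $m_0,L_0>0$ with $m_n\ge m_0$ and $L_n\le L_0$ for all $n$; (3) for all $n,m\in\mathbb N$ there are $F_n^m\ge0$, $\delta_n^m\ge0$ with $\|\mathcal S_nv(t)-\mathcal Sv(t)\|_X\le F_n^m\big(\max_{s\in[0,m]}\|v(s)\|_X+\delta_n^m\big)$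 for all $v\in C(\mathbb R_+;X)$, $t\in[0,m]$; moreover, for every $m$, $\lim_{n\to\infty}F_n^m=0$ and $\{\delta_n^m\}_n$ is bounded; (4) for each $m\in\mathbb N$ there is $s_m^0>0$ with $s_m^n\le s_m^0$ for all $n$; (5) whenever $z_n\rightharpoonup z$ in $X$ and $\mu_n\rightharpoonup\mu$ in $Y$, one has $\limsup_n b_n(w-z_n,\mu_n)\le b(w-z,\mu)$ for all $w\in X$; (6) there are $\alpha_0,M_0>0$ with $\alpha_n\ge\alpha_0$ and $M_n\le M_0$ for all $n$; (7) whenever $v_n\rightharpoonup v$ in $X$, one has $\pi v_n\to\pi v$ in $Z$; (8) $\{\Lambda_n\}$ converges to $\Lambda$ in the sense of Mosco: (a) for each $\mu\in\Lambda$ there is a sequence with $\mu_n\in\Lambda_n$ for all $n$ and $\mu_n\to\mu$ in $Y$; (b) if $\mu_n\in\Lambda_n$ for all $n$ and $\mu_n\rightharpoonup\mu$ in $Y$, then $\mu\in\Lambda$; (9) $f_n(t)\rightharpoonup f(t)$ in $Z$ for every $t\in\mathbb R_+$, and for each $m\in\mathbb N$ there is $\omega_m>0$ with $\|f_n(t)\|_Z\le\omega_m$ for all $t\in[0,m]$, $n\in\mathbb N$; (10) $h_n(t)\rightharpoonup h(t)$ in $X$ for every $t\in\mathbb R_+$, and for each $m\in\mathbb N$ there is $\xi_m>0$ with $\|h_n(t)\|_X\le\xi_m$ for all $t\in[0,m]$, $n\in\mathbb N$. Let $(u,\lambda)\in C(\mathbb R_+;X\times\Lambda)$ be the unique solution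 of: for all $t\in\mathbb R_+$, $$(Au(t),v)_X+(\mathcal Su(t),v)_X+b(v,\lambda(t))=(f(t),\pi v)_Z\quad\forall v\in X,$$ $$b(u(t),\mu-\lambda(t))\le b(h(t),\mu-\lambda(t))\quad\forall\mu\in\Lambda,$$ and for each $n$ let $(u_n,\lambda_n)\in C(\mathbb R_+;X\times\Lambda_n)$ be the unique solution of: for all $t\in\mathbb R_+$, $$(A_nu_n(t),v)_X+(\mathcal S_nu_n(t),v)_X+b_n(v,\lambda_n(t))=(f_n(t),\pi v)_Z\quad\forall v\in X,$$ $$b_n(u_n(t),\mu-\lambda_n(t))\le b_n(h_n(t),\mu-\lambda_n(t))\quad\forall\mu\in\Lambda_n.$$ Then for every $t\in\mathbb R_+$, as $n\to\infty$, $$u_n(t)\to u(t)\ \text{ strongly in }X,\qquad \lambda_n(t)\rightharpoonup\lambda(t)\ \text{ weakly in }Y.$$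
   Context: $\mathbb R_+=[0,+\infty)$; $C(\mathbb R_+;E)$ is the set of continuous functions from $\mathbb R_+$ to $E$. The symbols $\to$ and $\rightharpoonup$ denote strong and weak convergence; limits are as $n\to\infty$. - For $m_A,L_A>0$, $A:X\to X$ (possibly nonlinear) is called $(m_A,L_A)$-strongly monotone Lipschitz if $(Au-Av,u-v)_X\ge m_A\|u-v\|_X^2$ and $\|Au-Av\|_X\le L_A\|u-v\|_X$ for all $u,v\in X$. - $\mathcal S:C(\mathbb R_+;X)\to C(\mathbb R_+;X)$ is called history-dependent with constants $s_m\ge0$ ($m\in\mathbb N$) if for each $m\in\mathbb N$: $\|\mathcal Su_1(t)-\mathcal Su_2(t)\|_X\le s_m\int_0^t\|u_1(s)-u_2(s)\|_X\,ds$ for all $u_1,u_2\in C(\mathbb R_+;X)$, $t\in[0,m]$. - For $M_b,\alpha_b>0$, a bilinear form $b:X\times Y\to\mathbb R$ is called an $(M_b,\alpha_b)$-inf-sup bilinear form if $|b(v,\mu)|\le M_b\|v\|_X\|\mu\|_Y$ for all $v\in X,\mu\in Y$, and $\inf_{\mu\in Y,\mu\ne0_Y}\sup_{v\in X,v\ne0_X}\frac{b(v,\mu)}{\|v\|_X\|\mu\|_Y}\ge\alpha_b$. Under the stated hypotheses on the data, both mixed problems are uniquely solvable with the stated regularity.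
   Formalization: Condition (8b) is required along subsequences, as in Mosco's definition: weak limits of μ_k ∈ Λ_{r(k)}, r strictly increasing, lie in Λ. With full sequences only, the claim fails: Λ=[0,1], Λ_n alternating between [0,1] and [0,2]. *)

theory Defs
  imports "HOL-Analysis.Analysis"
begin

text \<open>
  Real Hilbert spaces are types of sort \<open>{real_inner, complete_space}\<close>.
  A function on \<open>[0, \<infinity>)\<close> is represented by a function on all of \<^typ>\<open>real\<close> whose values at
  negative arguments are unconstrained and irrelevant.
\<close>

definition cont_Rplus :: "'e::topological_space set \<Rightarrow> (real \<Rightarrow> 'e) set" where
  "cont_Rplus E = {u. continuous_on {0..} u \<and> u ` {0..} \<subseteq> E}"

definition weakly_converges :: "(nat \<Rightarrow> 'a::real_normed_vector) \<Rightarrow> 'a \<Rightarrow> bool" where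
  "weakly_converges x l \<longleftrightarrow>
     (\<forall>\<phi> :: 'a \<Rightarrow> real. bounded_linear \<phi> \<longrightarrow> (\<lambda>n. \<phi> (x n)) \<longlonglongrightarrow> \<phi> l)"

definition strongly_monotone_Lipschitz ::
    "real \<Rightarrow> real \<Rightarrow> ('a::real_inner \<Rightarrow> 'a) \<Rightarrow> bool" where
  "strongly_monotone_Lipschitz m L A \<longleftrightarrow> m > 0 \<and> L > 0 \<and>
     (\<forall>u v. (A u - A v) \<bullet> (u - v) \<ge> m * (norm (u - v))\<^sup>2) \<and>
     (\<forall>u v. norm (A u - A v) \<le> L * norm (u - v))"

text \<open>
  Any two representatives of the same element of \<open>C([0, \<infinity>); X)\<close> are at integral distance 0, so the
  inequality below forces \<open>S u\<close> on \<open>[0, \<infinity>)\<close> to depend only on \<open>u\<close> on \<open>[0, \<infinity>)\<close>.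
\<close>

definition history_dependent ::
    "(nat \<Rightarrow> real) \<Rightarrow> ((real \<Rightarrow> 'a::real_normed_vector) \<Rightarrow> (real \<Rightarrow> 'a)) \<Rightarrow> bool" where
  "history_dependent s S \<longleftrightarrow> S \<in> cont_Rplus UNIV \<rightarrow> cont_Rplus UNIV \<and> (\<forall>m. s m \<ge> 0) \<and>
     (\<forall>m. \<forall>u\<^sub>1\<in>cont_Rplus UNIV. \<forall>u\<^sub>2\<in>cont_Rplus UNIV. \<forall>t\<in>{0..real m}.
        norm (S u\<^sub>1 t - S u\<^sub>2 t) \<le> s m * integral {0..t} (\<lambda>r. norm (u\<^sub>1 r - u\<^sub>2 r)))"

text \<open>
  The infimum and supremum are taken in \<^typ>\<open>ereal\<close>, so that they have their usual values
  also when the supremum is infinite or one of the spaces is trivial.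
\<close>

definition inf_sup_bilinear ::
    "real \<Rightarrow> real \<Rightarrow> ('a::real_normed_vector \<Rightarrow> 'b::real_normed_vector \<Rightarrow> real) \<Rightarrow> bool" where
  "inf_sup_bilinear M \<alpha> b \<longleftrightarrow> M > 0 \<and> \<alpha> > 0 \<and> bilinear b \<and>
     (\<forall>v \<mu>. \<bar>b v \<mu>\<bar> \<le> M * norm v * norm \<mu>) \<and>
     (INF \<mu>\<in>{\<mu>. \<mu> \<noteq> 0}. SUP v\<in>{v. v \<noteq> 0}. ereal (b v \<mu> / (norm v * norm \<mu>))) \<ge> ereal \<alpha>"

text \<open>
  The weak part of Mosco convergence is required along subsequences, as in Mosco's definition
  (every weak cluster point of selections \<open>\<mu>\<^sub>n \<in> K\<^sub>n\<close> belongs to \<open>K\<close>). Full sequences only would not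
  do: in \<open>\<real>\<close>, the sets \<open>K\<^sub>n = [0, 1]\<close> for even and \<open>K\<^sub>n = [0, 2]\<close> for odd \<open>n\<close> would then
  converge to \<open>K = [0, 1]\<close>.
\<close>

definition Mosco_converges :: "(nat \<Rightarrow> 'b::real_normed_vector set) \<Rightarrow> 'b set \<Rightarrow> bool" where
  "Mosco_converges K\<^sub>n K \<longleftrightarrow>
     (\<forall>\<mu>\<in>K. \<exists>\<mu>\<^sub>n. (\<forall>n. \<mu>\<^sub>n n \<in> K\<^sub>n n) \<and> \<mu>\<^sub>n \<longlonglongrightarrow> \<mu>) \<and>
     (\<forall>r \<mu>\<^sub>n \<mu>. strict_mono r \<and> (\<forall>n. \<mu>\<^sub>n n \<in> K\<^sub>n (r n)) \<and> weakly_converges \<mu>\<^sub>n \<mu> \<longrightarrow> \<mu> \<in> K)"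

definition mixed_solution ::
    "('a::real_inner \<Rightarrow> 'a) \<Rightarrow> ((real \<Rightarrow> 'a) \<Rightarrow> (real \<Rightarrow> 'a)) \<Rightarrow> ('a \<Rightarrow> 'b::real_inner \<Rightarrow> real) \<Rightarrow>
     'b set \<Rightarrow> ('a \<Rightarrow> 'c::real_inner) \<Rightarrow> (real \<Rightarrow> 'c) \<Rightarrow> (real \<Rightarrow> 'a) \<Rightarrow>
     (real \<Rightarrow> 'a) \<Rightarrow> (real \<Rightarrow> 'b) \<Rightarrow> bool" where
  "mixed_solution A S b K \<pi> f h u l \<longleftrightarrow>
     (\<lambda>t. (u t, l t)) \<in> cont_Rplus (UNIV \<times> K) \<and>
     (\<forall>t\<ge>0.
        (\<forall>v. A (u t) \<bullet> v + S u t \<bullet> v + b v (l t) = f t \<bullet> \<pi> v) \<and>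
        (\<forall>\<mu>\<in>K. b (u t) (\<mu> - l t) \<le> b (h t) (\<mu> - l t)))"

end

theory Submission
  imports Defs "HOL-Complex_Analysis.Great_Picard"
begin

text \<open>
  Testing the \<open>n\<close>-th equation with \<open>u\<^sub>n - u\<close> gives
  \<open>m\<^sub>0 \<parallel>u\<^sub>n - u\<parallel>\<^sup>2 \<le> s\<^sub>0 \<parallel>u\<^sub>n - u\<parallel> \<integral>\<parallel>u\<^sub>n - u\<parallel> + R\<^sub>n\<close> with a remainder \<open>R\<^sub>n\<close> that involves only the data,
  \<open>u\<^sub>n - u\<close> and \<open>\<lambda>\<^sub>n\<close>. The choice \<open>\<mu> = 0\<close> in the inequality, the inf-sup condition and Gronwall's lemma
  bound \<open>u\<^sub>n\<close> and \<open>\<lambda>\<^sub>n\<close> uniformly on \<open>[0, m]\<close>. The hypothesis on \<open>b\<^sub>n\<close> in fact means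
  \<open>b\<^sub>n(z\<^sub>n, \<mu>\<^sub>n) \<rightarrow> b(z, \<mu>)\<close> along weakly convergent sequences, so at a weak cluster point \<open>(v, \<mu>)\<close> of
  \<open>(u\<^sub>n(t), \<lambda>\<^sub>n(t))\<close> the remainder tends to \<open>b(v - u(t), \<lambda>(t) - \<mu>)\<close>, which is \<open>\<le> 0\<close> by adding the limit of
  the \<open>n\<close>-th inequality to the inequality for \<open>u\<close>. Hence the positive part of \<open>R\<^sub>n\<close> vanishes
  pointwise and boundedly, and Gronwall's lemma with dominated convergence gives \<open>u\<^sub>n(t) \<rightarrow> u(t)\<close>;
  no auxiliary problem with frozen history has to be solved. Passing to the limit in the equation
  then identifies every weak cluster point of \<open>\<lambda>\<^sub>n(t)\<close> through the inf-sup condition.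
\<close>

section \<open>Subsequences and weak compactness in Hilbert spaces\<close>

lemma LIMSEQ_if_subseq:
  fixes a :: "nat \<Rightarrow> 'a::metric_space"
  assumes "\<And>r :: nat \<Rightarrow> nat. strict_mono r \<Longrightarrow> \<exists>q :: nat \<Rightarrow> nat. strict_mono q \<and> (\<lambda>k. a (r (q k))) \<longlonglongrightarrow> c"
  shows "a \<longlonglongrightarrow> c"
proof (rule ccontr)
  assume "\<not> a \<longlonglongrightarrow> c"
  then obtain e where e: "e > 0" and "\<forall>N. \<exists>n\<ge>N. \<not> dist (a n) c < e"
    by (auto simp: lim_sequentially)
  then have "\<exists>\<^sub>\<infinity>n. \<not> dist (a n) c < e"
    by (simp add: INFM_nat_le)
  from infinite_enumerate[OF this[unfolded INFM_iff_infinite]]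
  obtain r :: "nat \<Rightarrow> nat" where r: "strict_mono r" "\<And>n. \<not> dist (a (r n)) c < e"
    by blast
  from assms[OF r(1)] obtain q where "(\<lambda>k. a (r (q k))) \<longlonglongrightarrow> c" by blast
  with e obtain N where "dist (a (r (q N))) c < e"
    by (auto simp: lim_sequentially)
  with r(2) show False by blast
qed

text \<open>The minimizer of \<open>\<parallel>v\<parallel>\<^sup>2 - 2 \<phi> v\<close> over \<open>V\<close> represents \<open>\<phi>\<close>; minimizing sequences are Cauchy by the
  parallelogram law.\<close>

lemma Riesz_representation_on_subspace:
  fixes V :: "'a::{real_inner,complete_space} set" and \<phi> :: "'a \<Rightarrow> real"
  assumes V: "subspace V" "closed V"
    and add: "\<And>v w. v \<in> V \<Longrightarrow> w \<in> V \<Longrightarrow> \<phi> (v + w) = \<phi> v + \<phi> w"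
    and scale: "\<And>c v. v \<in> V \<Longrightarrow> \<phi> (c *\<^sub>R v) = c * \<phi> v"
    and bound: "\<And>v. v \<in> V \<Longrightarrow> \<bar>\<phi> v\<bar> \<le> K * norm v"
  obtains a where "a \<in> V" "\<And>v. v \<in> V \<Longrightarrow> \<phi> v = v \<bullet> a"
proof -
  define J where "J v = (norm v)\<^sup>2 - 2 * \<phi> v" for v
  \<comment> \<open>Expanding \<open>(norm v - K)\<^sup>2 \<ge> 0\<close> bounds
    \<open>(norm v)\<^sup>2 - 2 * K * norm v\<close> from below, and this expression lies below
    \<open>J v\<close>.\<close>
  have J_ge: "J v \<ge> - K\<^sup>2" if "v \<in> V" for v
    using bound[OF that] zero_le_power2[of "norm v - K"]
    unfolding J_def by (auto simp: power2_eq_square algebra_simps abs_le_iff)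
  define d where "d = (INF v\<in>V. J v)"
  have V0: "0 \<in> V" using V(1) by (rule subspace_0)
  have bdd: "bdd_below (J ` V)" using J_ge by (intro bdd_belowI2)
  have d_le: "d \<le> J v" if "v \<in> V" for v
    unfolding d_def using bdd that by (rule cINF_lower)
  have "\<exists>v\<in>V. J v < d + 1 / (Suc n)" for n
  proof -
    have "\<exists>y\<in>J ` V. y < d + 1 / (Suc n)"
      by (rule cInf_lessD) (use V0 in \<open>auto simp: d_def\<close>)
    then show ?thesis by auto
  qed
  then obtain x where x: "\<And>n. x n \<in> V" "\<And>n. J (x n) < d + 1 / (Suc n)" by metis
  have par: "(norm (v - w))\<^sup>2 \<le> 2 * (J v - d) + 2 * (J w - d)" if "v \<in> V" "w \<in> V" for v w
  proof -
    have mid: "(1/2) *\<^sub>R (v + w) \<in> V"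
      using that V(1) by (intro subspace_scale subspace_add)
    have "\<phi> ((1/2) *\<^sub>R (v + w)) = (\<phi> v + \<phi> w) / 2"
      using that V(1) by (subst scale) (auto simp: add intro: subspace_add)
    moreover have "(norm ((1/2) *\<^sub>R (v + w)))\<^sup>2 = (norm (v + w))\<^sup>2 / 4"
      by (simp only: norm_scaleR power_mult_distrib) (simp add: power2_eq_square)
    \<comment> \<open>The linear parts of \<open>J\<close> cancel against those at the midpoint; the
      parallelogram law evaluates what remains.\<close>
    ultimately have "(norm (v - w))\<^sup>2 = 2 * (J v + J w - 2 * J ((1/2) *\<^sub>R (v + w)))"
      unfolding J_def
      by (simp add: power2_norm_eq_inner inner_diff inner_add inner_commute algebra_simps)
    with d_le[OF mid] show ?thesis by simp
  qed
  have "Cauchy x"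
  proof (rule metric_CauchyI)
    fix e :: real assume e: "e > 0"
    \<comment> \<open>A quarter of \<open>e\<^sup>2\<close>, because \<open>par\<close> adds two
      gaps to the infimum, each with factor 2.\<close>
    then obtain N where N: "inverse (real (Suc N)) < e\<^sup>2 / 4"
      using reals_Archimedean[of "e\<^sup>2 / 4"] by auto
    have "dist (x m) (x n) < e" if "m \<ge> N" "n \<ge> N" for m n
    proof -
      have "1 / (real (Suc k)) \<le> inverse (real (Suc N))" if "k \<ge> N" for k
        using that by (simp add: field_simps)
      then have "J (x m) - d < e\<^sup>2 / 4" "J (x n) - d < e\<^sup>2 / 4"
        using x(2)[of m] x(2)[of n] that N by (smt (verit))+
      then have "(norm (x m - x n))\<^sup>2 < e\<^sup>2"
        using par[OF x(1)[of m] x(1)[of n]] by argo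
      then show ?thesis
        using e by (simp add: dist_norm power_less_imp_less_base)
    qed
    then show "\<exists>M. \<forall>m\<ge>M. \<forall>n\<ge>M. dist (x m) (x n) < e" by blast
  qed
  then obtain a where a: "x \<longlonglongrightarrow> a" using Cauchy_convergent convergent_def by blast
  have aV: "a \<in> V" using V(2) x(1) a by (rule closed_sequentially)
  have \<phi>_diff: "\<phi> (v - w) = \<phi> v - \<phi> w" if "v \<in> V" "w \<in> V" for v w
    using add[of v "- w"] scale[of w "-1"] that V(1) by (simp add: subspace_neg)
  have "(\<lambda>n. \<phi> (x n) - \<phi> a) \<longlonglongrightarrow> 0"
  proof (rule Lim_null_comparison)
    show "\<forall>\<^sub>F n in sequentially. norm (\<phi> (x n) - \<phi> a) \<le> K * norm (x n - a)"
      using bound[OF subspace_diff[OF V(1) x(1) aV]] \<phi>_diff[OF x(1) aV]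
      by (intro always_eventually) simp
    show "(\<lambda>n. K * norm (x n - a)) \<longlonglongrightarrow> 0"
      using a by (intro tendsto_mult_right_zero tendsto_norm_zero) (simp add: LIM_zero)
  qed
  then have "(\<lambda>n. \<phi> (x n)) \<longlonglongrightarrow> \<phi> a" by (rule LIM_zero_cancel)
  then have lim1: "(\<lambda>n. J (x n)) \<longlonglongrightarrow> J a"
    unfolding J_def by (intro tendsto_intros a)
  have lim2: "(\<lambda>n. d + 1 / (Suc n)) \<longlonglongrightarrow> d + 0"
    by (intro tendsto_intros LIMSEQ_Suc lim_const_over_n)
  have Ja: "J a \<le> d"
    using LIMSEQ_le[OF lim1 lim2] x(2) by (force intro: less_imp_le)
  have rep: "\<phi> v = v \<bullet> a" if v: "v \<in> V" for v
  proof -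
    define e where "e = v \<bullet> a - \<phi> v"
    have ineq: "0 \<le> t\<^sup>2 * (norm v)\<^sup>2 + 2 * t * e" for t
    proof -
      have "a + t *\<^sub>R v \<in> V" using V(1) aV v by (intro subspace_add subspace_scale)
      then have "J a \<le> J (a + t *\<^sub>R v)" using Ja d_le by force
      moreover have "\<phi> (a + t *\<^sub>R v) = \<phi> a + t * \<phi> v"
        using V(1) aV v by (simp add: add scale subspace_scale)
      ultimately show ?thesis
        unfolding J_def e_def
        by (simp add: power2_norm_eq_inner inner_add inner_commute algebra_simps power2_eq_square[of t])
    qed
    have "e = 0"
    proof (cases "v = 0")
      case True
      then show ?thesis using bound[OF v] by (simp add: e_def)
    next
      case False
      \<comment> \<open>The inserted \<open>t\<close> minimizes the quadratic in
        \<open>ineq\<close>; a nonnegative minimum forces \<open>e = 0\<close>.\<close>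
      have eq: "(- e / (norm v)\<^sup>2)\<^sup>2 * (norm v)\<^sup>2 + 2 * (- e / (norm v)\<^sup>2) * e = - (e\<^sup>2 / (norm v)\<^sup>2)"
        using False by (simp add: field_simps power2_eq_square)
      have "e\<^sup>2 / (norm v)\<^sup>2 \<le> 0"
        using ineq[of "- e / (norm v)\<^sup>2"] unfolding eq by simp
      then show ?thesis using False
        by (simp add: divide_le_0_iff)
    qed
    then show ?thesis by (simp add: e_def)
  qed
  from that[OF aV] rep show thesis by blast
qed

text \<open>A diagonal selection over the countable set \<open>range x\<close> makes the inner
  products with every member of the sequence converge. The vectors for which they converge form a
  closed subspace \<open>V\<close> that contains the sequence. Riesz representation on
  \<open>V\<close> serves twice: it turns the limit functional into the weak limit \<open>l\<close>,
  and it replaces an arbitrary functional by an element of \<open>V\<close>.\<close>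

lemma bounded_sequence_weakly_convergent_subsequence:
  fixes x :: "nat \<Rightarrow> 'a::{real_inner,complete_space}"
  assumes B: "\<And>n. norm (x n) \<le> B"
  obtains r l where "strict_mono (r :: nat \<Rightarrow> nat)" "weakly_converges (\<lambda>n. x (r n)) l"
proof -
  have B0: "B \<ge> 0" using B[of 0] norm_ge_zero order_trans by blast
  have bound: "norm (x n \<bullet> y) \<le> B * B" if "y \<in> range x" for n y
    using that B B0 order_trans[OF Cauchy_Schwarz_ineq2[of "x n" y] mult_mono] by auto
  obtain r :: "nat \<Rightarrow> nat" where r: "strict_mono r" and
    lim: "\<And>y. y \<in> range x \<Longrightarrow> \<exists>l. (\<lambda>n. x (r n) \<bullet> y) \<longlonglongrightarrow> l"
    by (rule function_convergent_subsequence[of "range x" "\<lambda>n y. x n \<bullet> y", OF _ bound]) auto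
  define V where "V = {y. convergent (\<lambda>n. x (r n) \<bullet> y)}"
  define \<Phi> where "\<Phi> y = lim (\<lambda>n. x (r n) \<bullet> y)" for y
  have \<Phi>: "(\<lambda>n. x (r n) \<bullet> y) \<longlonglongrightarrow> \<Phi> y" if "y \<in> V" for y
    using that unfolding V_def \<Phi>_def by (simp add: convergent_LIMSEQ_iff)
  have xV: "x n \<in> V" for n
    using lim[of "x n"] unfolding V_def convergent_def by auto
  have sub: "subspace V"
    unfolding V_def
    by (rule subspaceI) (auto simp: inner_add_right convergent_const intro: convergent_add convergent_mult)
  have clo: "closed V"
    unfolding closed_sequential_limits
  proof safe
    fix y l assume y: "\<forall>n. y n \<in> V" and l: "y \<longlonglongrightarrow> l"
    have "Cauchy (\<lambda>n. x (r n) \<bullet> l)"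
    proof (rule metric_CauchyI)
      fix e :: real assume e: "e > 0"
      \<comment> \<open>\<open>B + 1\<close> in place of \<open>B\<close> keeps the denominator
        positive when \<open>B = 0\<close>.\<close>
      then have "e / (3 * (B + 1)) > 0" using B0 by simp
      then obtain k where k: "dist (y k) l < e / (3 * (B + 1))"
        using l unfolding lim_sequentially by blast
      have "Cauchy (\<lambda>n. x (r n) \<bullet> y k)"
        using \<Phi> y LIMSEQ_imp_Cauchy by blast
      then obtain N where N: "\<And>m n. m \<ge> N \<Longrightarrow> n \<ge> N \<Longrightarrow> dist (x (r m) \<bullet> y k) (x (r n) \<bullet> y k) < e / 3"
        using e metric_CauchyD[of _ "e/3"] by (metis zero_less_divide_iff zero_less_numeral)
      have near: "\<bar>x n \<bullet> l - x n \<bullet> y k\<bar> < e / 3" for n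
      proof -
        have "\<bar>x n \<bullet> (l - y k)\<bar> \<le> B * dist (y k) l"
          using order_trans[OF Cauchy_Schwarz_ineq2 mult_right_mono[OF B norm_ge_zero]]
          by (simp add: dist_norm norm_minus_commute)
        also have "\<dots> \<le> (B + 1) * dist (y k) l" by (intro mult_right_mono) auto
        also have "\<dots> < e / 3" using k B0 by (simp add: field_simps)
        finally show ?thesis by (simp add: inner_diff_right)
      qed
      have "dist (x (r m) \<bullet> l) (x (r n) \<bullet> l) < e" if "m \<ge> N" "n \<ge> N" for m n
        using near[of "r m"] near[of "r n"] N[OF that] unfolding dist_real_def by linarith
      then show "\<exists>M. \<forall>m\<ge>M. \<forall>n\<ge>M. dist (x (r m) \<bullet> l) (x (r n) \<bullet> l) < e" by blast
    qed
    then show "l \<in> V" unfolding V_def by (simp add: Cauchy_convergent)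
  qed
  have \<Phi>_add: "\<Phi> (v + w) = \<Phi> v + \<Phi> w" if "v \<in> V" "w \<in> V" for v w
    using LIMSEQ_unique[OF \<Phi>[OF subspace_add[OF sub that]], of "\<Phi> v + \<Phi> w"] \<Phi> that
    by (simp add: inner_add_right tendsto_add)
  have \<Phi>_scale: "\<Phi> (c *\<^sub>R v) = c * \<Phi> v" if "v \<in> V" for c v
    using LIMSEQ_unique[OF \<Phi>[OF subspace_scale[OF sub that]], of c "c * \<Phi> v"] \<Phi> that
    by (simp add: tendsto_mult_left)
  have \<Phi>_bound: "\<bar>\<Phi> v\<bar> \<le> B * norm v" if "v \<in> V" for v
  proof (rule LIMSEQ_le_const2[OF tendsto_rabs[OF \<Phi>[OF that]]])
    show "\<exists>N. \<forall>n\<ge>N. \<bar>x (r n) \<bullet> v\<bar> \<le> B * norm v"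
      using order_trans[OF Cauchy_Schwarz_ineq2 mult_right_mono[OF B norm_ge_zero]] by blast
  qed
  obtain l where l: "l \<in> V" "\<And>v. v \<in> V \<Longrightarrow> \<Phi> v = v \<bullet> l"
    using Riesz_representation_on_subspace[OF sub clo \<Phi>_add \<Phi>_scale \<Phi>_bound] by blast
  have "weakly_converges (\<lambda>n. x (r n)) l"
    unfolding weakly_converges_def
  proof (intro allI impI)
    fix \<phi> :: "'a \<Rightarrow> real" assume "bounded_linear \<phi>"
    then interpret bounded_linear \<phi> .
    obtain K where "\<And>v. \<bar>\<phi> v\<bar> \<le> K * norm v"
      using bounded by (metis mult.commute real_norm_def)
    \<comment> \<open>A representation valid on \<open>V\<close> suffices, since the sequence and
      \<open>l\<close> both lie in \<open>V\<close>.\<close>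
    then obtain a where a: "a \<in> V" "\<And>v. v \<in> V \<Longrightarrow> \<phi> v = v \<bullet> a"
      using Riesz_representation_on_subspace[OF sub clo, of \<phi> K] add scaleR by auto
    show "(\<lambda>n. \<phi> (x (r n))) \<longlonglongrightarrow> \<phi> l"
      using \<Phi>[OF a(1)] xV l a by (simp add: inner_commute)
  qed
  with r that show thesis by blast
qed

section \<open>Calculus of weak convergence\<close>

lemma weakly_converges_bounded_linear:
  fixes T :: "'a::real_normed_vector \<Rightarrow> 'b::real_normed_vector"
  assumes "weakly_converges x l" "bounded_linear T"
  shows "weakly_converges (\<lambda>n. T (x n)) (T l)"
  unfolding weakly_converges_def
proof (intro allI impI)
  fix \<phi> :: "'b \<Rightarrow> real" assume "bounded_linear \<phi>"
  then have "bounded_linear (\<phi> \<circ> T)"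
    using assms(2) bounded_linear_compose unfolding comp_def by blast
  with assms(1) show "(\<lambda>n. \<phi> (T (x n))) \<longlonglongrightarrow> \<phi> (T l)"
    unfolding weakly_converges_def by fastforce
qed

lemma weakly_converges_inner:
  "weakly_converges x l \<Longrightarrow> (\<lambda>n. x n \<bullet> v) \<longlonglongrightarrow> l \<bullet> v"
  using bounded_linear_inner_left unfolding weakly_converges_def by blast

lemma weakly_converges_subseq:
  "weakly_converges x l \<Longrightarrow> strict_mono r \<Longrightarrow> weakly_converges (\<lambda>n. x (r n)) l"
  unfolding weakly_converges_def using LIMSEQ_subseq_LIMSEQ by (fastforce simp: comp_def)

lemma tendsto_imp_weakly_converges: "x \<longlonglongrightarrow> l \<Longrightarrow> weakly_converges x l"
  unfolding weakly_converges_def using bounded_linear.tendsto by blast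

lemma weakly_converges_diff:
  assumes "weakly_converges x l" "weakly_converges y k"
  shows "weakly_converges (\<lambda>n. x n - y n) (l - k)"
  using assms unfolding weakly_converges_def
  by (simp add: bounded_linear.linear linear_diff tendsto_diff)

text \<open>Boundedness of the weak factor kills \<open>x n \<bullet> (y n - k)\<close>, and the
  rest is weak convergence tested with the fixed vector \<open>k\<close>. In the applications the
  bound comes from the data or from the a priori estimates.\<close>

lemma weak_strong_inner:
  assumes x: "weakly_converges x l" "\<And>n. norm (x n) \<le> B" and y: "y \<longlonglongrightarrow> k"
  shows "(\<lambda>n. x n \<bullet> y n) \<longlonglongrightarrow> l \<bullet> k"
proof -
  have "(\<lambda>n. x n \<bullet> (y n - k)) \<longlonglongrightarrow> 0"
  proof (rule Lim_null_comparison)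
    show "\<forall>\<^sub>F n in sequentially. norm (x n \<bullet> (y n - k)) \<le> B * norm (y n - k)"
      using order_trans[OF Cauchy_Schwarz_ineq2 mult_right_mono[OF x(2) norm_ge_zero]]
      by (intro always_eventually) simp
    show "(\<lambda>n. B * norm (y n - k)) \<longlonglongrightarrow> 0"
      using y by (intro tendsto_mult_right_zero tendsto_norm_zero) (simp add: LIM_zero)
  qed
  from tendsto_add[OF this weakly_converges_inner[OF x(1), of k]] show ?thesis
    by (simp add: inner_diff_right)
qed

section \<open>Inf-sup bilinear forms and their limits\<close>

lemma inf_sup_bilinear_norm_le:
  assumes b: "inf_sup_bilinear M \<alpha> b" and K: "K \<ge> 0" "\<And>v. \<bar>b v \<mu>\<bar> \<le> K * norm v"
  shows "\<alpha> * norm \<mu> \<le> K"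
proof (cases "\<mu> = 0")
  case True
  with K show ?thesis by simp
next
  case False
  have "ereal \<alpha> \<le> (INF \<mu>\<in>{\<mu>. \<mu> \<noteq> 0}. SUP v\<in>{v. v \<noteq> 0}. ereal (b v \<mu> / (norm v * norm \<mu>)))"
    using b unfolding inf_sup_bilinear_def by blast
  also have "\<dots> \<le> (SUP v\<in>{v. v \<noteq> 0}. ereal (b v \<mu> / (norm v * norm \<mu>)))"
    using False by (intro INF_lower) simp
  \<comment> \<open>The factor \<open>norm v\<close> cancels, so one bound serves all quotients.
    Without any nonzero \<open>v\<close> the supremum is minus infinity and the estimate still
    holds.\<close>
  also have "\<dots> \<le> ereal (K / norm \<mu>)"
  proof (rule SUP_least)
    fix v :: 'a assume "v \<in> {v. v \<noteq> 0}"
    with False K(2)[of v] show "ereal (b v \<mu> / (norm v * norm \<mu>)) \<le> ereal (K / norm \<mu>)"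
      by (simp add: field_simps abs_le_iff)
  qed
  finally show ?thesis using False by (simp add: field_simps)
qed

lemma inf_sup_bilinear_bounded_bilinear:
  assumes "inf_sup_bilinear M \<alpha> b"
  shows "bounded_bilinear b"
proof
  show "\<exists>K. \<forall>v \<mu>. norm (b v \<mu>) \<le> norm v * norm \<mu> * K"
    using assms unfolding inf_sup_bilinear_def by (metis mult.assoc mult.commute real_norm_def)
qed (use assms in \<open>auto simp: inf_sup_bilinear_def bilinear_ladd bilinear_radd bilinear_lmul bilinear_rmul\<close>)

text \<open>The hypothesis on the forms \<open>b\<^sub>n\<close> speaks of full sequences with the
  same index as the form. Filling the gaps of a subsequence with its weak limit makes that
  hypothesis applicable along subsequences.\<close>

lemma weakly_converges_fill:
  assumes r: "strict_mono (r :: nat \<Rightarrow> nat)" and x: "weakly_converges x l"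
  obtains y where "weakly_converges y l" "\<And>k. y (r k) = x k"
proof
  define y where "y n = (if n \<in> range r then x (inv r n) else l)" for n
  show yr: "y (r k) = x k" for k
    using strict_mono_imp_inj_on[OF r] by (simp add: y_def)
  show "weakly_converges y l"
    unfolding weakly_converges_def
  proof (intro allI impI)
    fix \<phi> :: "'a \<Rightarrow> real" assume \<phi>: "bounded_linear \<phi>"
    show "(\<lambda>n. \<phi> (y n)) \<longlonglongrightarrow> \<phi> l"
    proof (rule metric_LIMSEQ_I)
      fix e :: real assume e: "e > 0"
      then obtain N where N: "\<And>k. k \<ge> N \<Longrightarrow> dist (\<phi> (x k)) (\<phi> l) < e"
        using x \<phi> metric_LIMSEQ_D unfolding weakly_converges_def by blast
      have "dist (\<phi> (y n)) (\<phi> l) < e" if n: "n \<ge> r N" for n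
      proof (cases "n \<in> range r")
        case True
        then obtain k where k: "n = r k" by blast
        with n r have "k \<ge> N" by (simp add: strict_mono_less_eq)
        with N k yr show ?thesis by simp
      next
        case False
        with e show ?thesis by (simp add: y_def)
      qed
      then show "\<exists>N. \<forall>n\<ge>N. dist (\<phi> (y n)) (\<phi> l) < e" by blast
    qed
  qed
qed

text \<open>Applying the one-sided hypothesis both to \<open>z\<^sub>n\<close> and to \<open>- z\<^sub>n\<close> turns it into a two-sided limit.\<close>

lemma bilinear_tendsto_if_limsup_le:
  assumes limsup_le: "\<And>z\<^sub>n z \<mu>\<^sub>n \<mu> w. weakly_converges z\<^sub>n z \<Longrightarrow> weakly_converges \<mu>\<^sub>n \<mu> \<Longrightarrow>
      limsup (\<lambda>n. ereal (b\<^sub>n n (w - z\<^sub>n n) (\<mu>\<^sub>n n))) \<le> ereal (b (w - z) \<mu>)"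
    and b: "bilinear b" and b\<^sub>n: "\<And>n. bilinear (b\<^sub>n n)"
    and r: "strict_mono (r :: nat \<Rightarrow> nat)"
    and z: "weakly_converges z\<^sub>n z" and \<mu>: "weakly_converges \<mu>\<^sub>n \<mu>"
  shows "(\<lambda>k. b\<^sub>n (r k) (z\<^sub>n k) (\<mu>\<^sub>n k)) \<longlonglongrightarrow> b z \<mu>"
proof -
  obtain \<mu>' where \<mu>': "weakly_converges \<mu>' \<mu>" "\<And>k. \<mu>' (r k) = \<mu>\<^sub>n k"
    using weakly_converges_fill[OF r \<mu>] by blast
  \<comment> \<open>The hypothesis is used with \<open>w = 0\<close> on the filled sequences;
    passing back to the subsequence cannot raise the limsup.\<close>
  have le: "limsup (\<lambda>k. ereal (b\<^sub>n (r k) (- y k) (\<mu>\<^sub>n k))) \<le> ereal (b (- z) \<mu>)"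
    if y: "weakly_converges y z" for y z
  proof -
    obtain y' where y': "weakly_converges y' z" "\<And>k. y' (r k) = y k"
      using weakly_converges_fill[OF r y] by blast
    have "limsup ((\<lambda>n. ereal (b\<^sub>n n (0 - y' n) (\<mu>' n))) \<circ> r) \<le> ereal (b (0 - z) \<mu>)"
      using limsup_subseq_mono[OF r] limsup_le[OF y'(1) \<mu>'(1)] order_trans by blast
    then show ?thesis by (simp add: comp_def y'(2) \<mu>'(2))
  qed
  have "weakly_converges (\<lambda>k. - z\<^sub>n k) (- z)"
    using z by (rule weakly_converges_bounded_linear) (rule bounded_linear_minus[OF bounded_linear_ident])
  from le[OF this] have upper: "limsup (\<lambda>k. ereal (b\<^sub>n (r k) (z\<^sub>n k) (\<mu>\<^sub>n k))) \<le> ereal (b z \<mu>)"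
    by simp
  from le[OF z] have lower: "limsup (\<lambda>k. ereal (- b\<^sub>n (r k) (z\<^sub>n k) (\<mu>\<^sub>n k))) \<le> ereal (- b z \<mu>)"
    by (simp add: bilinear_lneg[OF b] bilinear_lneg[OF b\<^sub>n])
  show ?thesis
  proof (rule order_tendstoI)
    fix a assume "a < b z \<mu>"
    then have "limsup (\<lambda>k. ereal (- b\<^sub>n (r k) (z\<^sub>n k) (\<mu>\<^sub>n k))) < ereal (- a)"
      using lower by (simp add: order.strict_trans1)
    from Limsup_lessD[OF this] show "\<forall>\<^sub>F k in sequentially. a < b\<^sub>n (r k) (z\<^sub>n k) (\<mu>\<^sub>n k)"
      by simp
  next
    fix a assume "b z \<mu> < a"
    then have "limsup (\<lambda>k. ereal (b\<^sub>n (r k) (z\<^sub>n k) (\<mu>\<^sub>n k))) < ereal a"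
      using upper by (simp add: order.strict_trans1)
    from Limsup_lessD[OF this] show "\<forall>\<^sub>F k in sequentially. b\<^sub>n (r k) (z\<^sub>n k) (\<mu>\<^sub>n k) < a"
      by simp
  qed
qed

section \<open>Gronwall estimates\<close>

lemma Gronwall_integral:
  fixes d g :: "real \<Rightarrow> real"
  assumes d: "continuous_on {0..T} d" and g: "continuous_on {0..T} g"
    and C: "C \<ge> 0" and g0: "\<And>t. t \<in> {0..T} \<Longrightarrow> g t \<ge> 0"
    and le: "\<And>t. t \<in> {0..T} \<Longrightarrow> d t \<le> C * integral {0..t} d + g t"
    and t: "t \<in> {0..T}"
  shows "integral {0..t} d \<le> exp (C * T) * integral {0..T} g"
proof -
  define H where "H = (\<lambda>\<tau>. exp (- C * \<tau>) * integral {0..\<tau>} d - integral {0..\<tau>} g)"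
  have deriv: "(H has_real_derivative exp (- C * \<tau>) * (d \<tau> - C * integral {0..\<tau>} d) - g \<tau>)
      (at \<tau> within {0..T})" if "\<tau> \<in> {0..T}" for \<tau>
  proof -
    have "((\<lambda>\<tau>. exp (- C * \<tau>)) has_real_derivative - C * exp (- C * \<tau>)) (at \<tau> within {0..T})"
      by (auto intro!: derivative_eq_intros)
    from DERIV_diff[OF DERIV_mult[OF this integral_has_real_derivative[OF d that]]
        integral_has_real_derivative[OF g that]]
    show ?thesis unfolding H_def by (rule DERIV_cong) (simp add: algebra_simps)
  qed
  \<comment> \<open>Derivatives at the endpoints of \<open>{0..T}\<close> are one-sided, so
    monotonicity is drawn from interior points together with continuity.\<close>
  have "H t \<le> H 0"
  proof (rule DERIV_nonpos_imp_decreasing_open[where f = H])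
    show "0 \<le> t" using t by simp
    have "continuous_on {0..T} H"
      using deriv by (meson DERIV_continuous continuous_on_eq_continuous_within)
    then show "continuous_on {0..t} H"
      by (rule continuous_on_subset) (use t in auto)
  next
    fix \<tau> assume \<tau>: "0 < \<tau>" "\<tau> < t"
    then have \<tau>T: "\<tau> \<in> {0..T}" "\<tau> \<in> interior {0..T}" using t by auto
    have "exp (- C * \<tau>) * (d \<tau> - C * integral {0..\<tau>} d) \<le> exp (- C * \<tau>) * g \<tau>"
      using le[OF \<tau>T(1)] by (intro mult_left_mono) auto
    also have "\<dots> \<le> 1 * g \<tau>"
      using C \<tau> g0[OF \<tau>T(1)] by (intro mult_right_mono) auto
    finally show "\<exists>y. DERIV H \<tau> :> y \<and> y \<le> 0"
      using deriv[OF \<tau>T(1)] at_within_interior[OF \<tau>T(2)] by force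
  qed
  then have "exp (- C * t) * integral {0..t} d \<le> integral {0..t} g"
    by (simp add: H_def)
  then have "integral {0..t} d \<le> exp (C * t) * integral {0..t} g"
    by (simp add: exp_minus field_simps)
  also have "\<dots> \<le> exp (C * T) * integral {0..T} g"
  proof (rule mult_mono)
    show "exp (C * t) \<le> exp (C * T)" using C t by (simp add: mult_left_mono)
    have sub: "{0..t} \<subseteq> {0..T}" using t by auto
    show "integral {0..t} g \<le> integral {0..T} g"
      using sub g0 by (intro integral_subset_le integrable_continuous_real continuous_on_subset[OF g]) auto
    show "0 \<le> integral {0..t} g"
      using sub g0 by (intro integral_nonneg integrable_continuous_real continuous_on_subset[OF g]) auto
  qed simp
  finally show ?thesis .
qed

text \<open>Pointwise convergence of \<open>g\<close> with a constant dominating bound makes its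
  integrals vanish. Gronwall then squeezes the integrals of \<open>d\<close>, and feeding these back
  into the inequality squeezes \<open>d\<close> itself.\<close>

lemma Gronwall_null_sequence:
  fixes d g :: "nat \<Rightarrow> real \<Rightarrow> real"
  assumes d: "\<And>n. continuous_on {0..T} (d n)" "\<And>n t. t \<in> {0..T} \<Longrightarrow> d n t \<ge> 0"
    and g: "\<And>n. continuous_on {0..T} (g n)" "\<And>n t. t \<in> {0..T} \<Longrightarrow> 0 \<le> g n t \<and> g n t \<le> B"
      "\<And>t. t \<in> {0..T} \<Longrightarrow> (\<lambda>n. g n t) \<longlonglongrightarrow> 0"
    and C: "C \<ge> 0"
    and le: "\<And>n t. t \<in> {0..T} \<Longrightarrow> d n t \<le> C * integral {0..t} (d n) + g n t"
    and t: "t \<in> {0..T}"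
  shows "(\<lambda>n. integral {0..t} (d n)) \<longlonglongrightarrow> 0" "(\<lambda>n. d n t) \<longlonglongrightarrow> 0"
proof -
  have "(\<lambda>n. integral {0..T} (g n)) \<longlonglongrightarrow> integral {0..T} (\<lambda>_. 0)"
    by (rule dominated_convergence(2)[where h = "\<lambda>_. B"])
      (use g in \<open>auto intro: integrable_continuous_real\<close>)
  then have lim: "(\<lambda>n. exp (C * T) * integral {0..T} (g n)) \<longlonglongrightarrow> 0"
    by (intro tendsto_mult_right_zero) simp
  have nonneg: "integral {0..t} (d n) \<ge> 0" for n
    using t d(2) by (intro integral_nonneg integrable_continuous_real continuous_on_subset[OF d(1)]) auto
  show lim_int: "(\<lambda>n. integral {0..t} (d n)) \<longlonglongrightarrow> 0"
    using nonneg Gronwall_integral[OF d(1) g(1) C _ le t] g(2)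
    by (intro tendsto_sandwich[OF _ _ tendsto_const lim]) auto
  have "(\<lambda>n. C * integral {0..t} (d n) + g n t) \<longlonglongrightarrow> 0"
    using tendsto_add[OF tendsto_mult_right_zero[OF lim_int] g(3)[OF t]] by simp
  then show "(\<lambda>n. d n t) \<longlonglongrightarrow> 0"
    by (rule tendsto_sandwich[OF _ _ tendsto_const, rotated 2]) (use d(2) le t in auto)
qed

section \<open>Scalar inequalities\<close>

lemma quadratic_le_imp_le:
  fixes d E :: real
  assumes "d\<^sup>2 \<le> E * (1 + d)" "d \<ge> 0" "E \<ge> 0"
  shows "d \<le> 1 + 2 * E"
proof (rule ccontr)
  assume "\<not> ?thesis"
  then have "d > 1 + 2 * E" by simp
  then have "d * d > (1 + 2 * E) * d" "d > 1" using assms by (auto intro!: mult_strict_right_mono)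
  moreover have "E * d \<ge> E * 1" using \<open>d > 1\<close> assms(3) by (intro mult_left_mono) auto
  ultimately show False using assms(1) by (simp add: power2_eq_square algebra_simps)
qed

text \<open>In contrast to \<open>quadratic_le_imp_le\<close> there is no additive constant, so the
  bound tends to 0 with \<open>a\<close> and \<open>c\<close>. If \<open>d - a\<close> exceeded
  \<open>sqrt c\<close>, then \<open>c < (d - a)\<^sup>2 \<le> (d - a) * d\<close>, against the
  hypothesis.\<close>

lemma quadratic_le_imp_le_sqrt:
  fixes d a c :: real
  assumes "d\<^sup>2 \<le> a * d + c" "a \<ge> 0" "c \<ge> 0"
  shows "d \<le> a + sqrt c"
proof (rule ccontr)
  assume "\<not> ?thesis"
  then have d: "d - a > sqrt c" by simp
  have "sqrt c \<ge> 0" using assms by simp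
  then have "sqrt c * sqrt c < (d - a) * (d - a)" by (intro mult_strict_mono) (use d \<open>sqrt c \<ge> 0\<close> in linarith)+
  also have "\<dots> \<le> (d - a) * d" by (intro mult_left_mono) (use d \<open>sqrt c \<ge> 0\<close> assms in linarith)+
  finally show False using assms by (simp add: power2_eq_square algebra_simps)
qed

lemma null_times_bounded:
  fixes F \<delta> :: "nat \<Rightarrow> real"
  assumes "F \<longlonglongrightarrow> 0" "bounded (range \<delta>)"
  shows "(\<lambda>n. F n * (c + \<delta> n)) \<longlonglongrightarrow> 0"
proof -
  obtain B where B: "\<And>n. \<bar>\<delta> n\<bar> \<le> B"
    using assms(2) unfolding bounded_iff by auto
  show ?thesis
  proof (rule Lim_null_comparison)
    show "\<forall>\<^sub>F n in sequentially. norm (F n * (c + \<delta> n)) \<le> \<bar>F n\<bar> * (\<bar>c\<bar> + B)"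
      by (intro always_eventually allI) (simp add: abs_mult mult_left_mono add_mono B abs_triangle_ineq[THEN order_trans])
    show "(\<lambda>n. \<bar>F n\<bar> * (\<bar>c\<bar> + B)) \<longlonglongrightarrow> 0"
      using assms(1) by (intro tendsto_mult_left_zero tendsto_rabs_zero)
  qed
qed

section \<open>The mixed problem: regularity and energy\<close>

lemma mixed_solutionD:
  assumes "mixed_solution A S b K \<pi> f h u l"
  shows "continuous_on {0..} u" "continuous_on {0..} l" "u \<in> cont_Rplus UNIV"
    and "t \<ge> 0 \<Longrightarrow> l t \<in> K"
    and "t \<ge> 0 \<Longrightarrow> A (u t) \<bullet> v + S u t \<bullet> v + b v (l t) = f t \<bullet> \<pi> v"
    and "t \<ge> 0 \<Longrightarrow> \<mu> \<in> K \<Longrightarrow> b (u t) (\<mu> - l t) \<le> b (h t) (\<mu> - l t)"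
proof -
  have c: "continuous_on {0..} (\<lambda>t. (u t, l t))"
    using assms by (simp add: mixed_solution_def cont_Rplus_def)
  from continuous_on_fst[OF c] show u: "continuous_on {0..} u" by simp
  from continuous_on_snd[OF c] show "continuous_on {0..} l" by simp
  from u show "u \<in> cont_Rplus UNIV" by (simp add: cont_Rplus_def)
qed (use assms in \<open>auto simp: mixed_solution_def cont_Rplus_def\<close>)

lemma strongly_monotone_Lipschitz_continuous_on:
  assumes "strongly_monotone_Lipschitz m L A" "continuous_on E u"
  shows "continuous_on E (\<lambda>t. A (u t))"
proof -
  have "L-lipschitz_on UNIV A"
    using assms(1) unfolding strongly_monotone_Lipschitz_def
    by (intro lipschitz_onI) (auto simp: dist_norm)
  from lipschitz_on_continuous_on[OF this] assms(2) show ?thesis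
    using continuous_on_compose2 by blast
qed

text \<open>Strong monotonicity is applied between \<open>p\<close> and \<open>u\<close>, and the
  equation tested with \<open>p - u\<close> eliminates \<open>A p\<close>. Here \<open>q\<close>
  stands for the value of the history operator.\<close>

lemma energy_estimate:
  fixes \<pi> :: "'x::real_inner \<Rightarrow> 'z::real_inner"
  assumes "strongly_monotone_Lipschitz m L A"
    and "A p \<bullet> (p - u) + q \<bullet> (p - u) + b (p - u) \<mu> = F \<bullet> \<pi> (p - u)"
  shows "m * (norm (p - u))\<^sup>2 \<le> F \<bullet> \<pi> (p - u) - b (p - u) \<mu> - (A u + q) \<bullet> (p - u)"
proof -
  have "m * (norm (p - u))\<^sup>2 \<le> (A p - A u) \<bullet> (p - u)"
    using assms(1) unfolding strongly_monotone_Lipschitz_def by blast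
  also have "\<dots> = A p \<bullet> (p - u) - A u \<bullet> (p - u)" by (rule inner_diff_left)
  finally show ?thesis using assms(2) by (simp add: inner_add_left)
qed

theorem theorem3p2:
  fixes \<pi> :: "'x::{real_inner,complete_space} \<Rightarrow> 'z::{real_inner,complete_space}"
    and A :: "'x \<Rightarrow> 'x" and A\<^sub>n :: "nat \<Rightarrow> 'x \<Rightarrow> 'x"
    and m\<^sub>A L\<^sub>A :: real and m\<^sub>n L\<^sub>n :: "nat \<Rightarrow> real"
    and S :: "(real \<Rightarrow> 'x) \<Rightarrow> (real \<Rightarrow> 'x)" and S\<^sub>n :: "nat \<Rightarrow> (real \<Rightarrow> 'x) \<Rightarrow> (real \<Rightarrow> 'x)"
    and s :: "nat \<Rightarrow> real" and s\<^sub>n :: "nat \<Rightarrow> nat \<Rightarrow> real"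
    and b :: "'x \<Rightarrow> 'y::{real_inner,complete_space} \<Rightarrow> real"
    and b\<^sub>n :: "nat \<Rightarrow> 'x \<Rightarrow> 'y \<Rightarrow> real"
    and M\<^sub>b \<alpha>\<^sub>b :: real and M\<^sub>n \<alpha>\<^sub>n :: "nat \<Rightarrow> real"
    and \<Lambda> :: "'y set" and \<Lambda>\<^sub>n :: "nat \<Rightarrow> 'y set"
    and f :: "real \<Rightarrow> 'z" and f\<^sub>n :: "nat \<Rightarrow> real \<Rightarrow> 'z"
    and h :: "real \<Rightarrow> 'x" and h\<^sub>n :: "nat \<Rightarrow> real \<Rightarrow> 'x"
    and u :: "real \<Rightarrow> 'x" and u\<^sub>n :: "nat \<Rightarrow> real \<Rightarrow> 'x"
    and l :: "real \<Rightarrow> 'y" and l\<^sub>n :: "nat \<Rightarrow> real \<Rightarrow> 'y"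
  assumes \<pi>: "bounded_linear \<pi>"
    and A: "strongly_monotone_Lipschitz m\<^sub>A L\<^sub>A A"
    and S: "history_dependent s S"
    and b: "inf_sup_bilinear M\<^sub>b \<alpha>\<^sub>b b"
    and \<Lambda>: "closed \<Lambda>" "convex \<Lambda>" "0 \<in> \<Lambda>"
    and f: "f \<in> cont_Rplus UNIV"
    and h: "h \<in> cont_Rplus UNIV"
    and A\<^sub>n: "\<forall>n. strongly_monotone_Lipschitz (m\<^sub>n n) (L\<^sub>n n) (A\<^sub>n n)"
    and S\<^sub>n: "\<forall>n. history_dependent (s\<^sub>n n) (S\<^sub>n n)"
    and b\<^sub>n: "\<forall>n. inf_sup_bilinear (M\<^sub>n n) (\<alpha>\<^sub>n n) (b\<^sub>n n)"
    and \<Lambda>\<^sub>n: "\<forall>n. closed (\<Lambda>\<^sub>n n) \<and> convex (\<Lambda>\<^sub>n n) \<and> 0 \<in> \<Lambda>\<^sub>n n"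
    and f\<^sub>n: "\<forall>n. f\<^sub>n n \<in> cont_Rplus UNIV"
    and h\<^sub>n: "\<forall>n. h\<^sub>n n \<in> cont_Rplus UNIV"
    and A\<^sub>n_conv: "\<exists>F \<delta> :: nat \<Rightarrow> real.
      (\<forall>n. F n \<ge> 0 \<and> \<delta> n \<ge> 0 \<and> (\<forall>v. norm (A\<^sub>n n v - A v) \<le> F n * (norm v + \<delta> n))) \<and>
      F \<longlonglongrightarrow> 0 \<and> bounded (range \<delta>)"
    and A\<^sub>n_unif: "\<exists>m\<^sub>0>0. \<exists>L\<^sub>0>0. \<forall>n. m\<^sub>n n \<ge> m\<^sub>0 \<and> L\<^sub>n n \<le> L\<^sub>0"
    and S\<^sub>n_conv: "\<exists>F \<delta> :: nat \<Rightarrow> nat \<Rightarrow> real.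
      (\<forall>n m. F n m \<ge> 0 \<and> \<delta> n m \<ge> 0 \<and>
        (\<forall>v\<in>cont_Rplus UNIV. \<forall>t\<in>{0..real m}.
           norm (S\<^sub>n n v t - S v t) \<le> F n m * ((SUP r\<in>{0..real m}. norm (v r)) + \<delta> n m))) \<and>
      (\<forall>m. (\<lambda>n. F n m) \<longlonglongrightarrow> 0 \<and> bounded (range (\<lambda>n. \<delta> n m)))"
    and s\<^sub>n_unif: "\<forall>m. \<exists>s\<^sub>0>0. \<forall>n. s\<^sub>n n m \<le> s\<^sub>0"
    and b\<^sub>n_limsup: "\<And>z\<^sub>n z \<mu>\<^sub>n \<mu> w. weakly_converges z\<^sub>n z \<Longrightarrow> weakly_converges \<mu>\<^sub>n \<mu> \<Longrightarrow>
      limsup (\<lambda>n. ereal (b\<^sub>n n (w - z\<^sub>n n) (\<mu>\<^sub>n n))) \<le> ereal (b (w - z) \<mu>)"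
    and b\<^sub>n_unif: "\<exists>\<alpha>\<^sub>0>0. \<exists>M\<^sub>0>0. \<forall>n. \<alpha>\<^sub>n n \<ge> \<alpha>\<^sub>0 \<and> M\<^sub>n n \<le> M\<^sub>0"
    and \<pi>_weak_strong: "\<And>v\<^sub>n v. weakly_converges v\<^sub>n v \<Longrightarrow> (\<lambda>n. \<pi> (v\<^sub>n n)) \<longlonglongrightarrow> \<pi> v"
    and \<Lambda>\<^sub>n_Mosco: "Mosco_converges \<Lambda>\<^sub>n \<Lambda>"
    and f\<^sub>n_conv: "\<forall>t\<ge>0. weakly_converges (\<lambda>n. f\<^sub>n n t) (f t)"
    and f\<^sub>n_unif: "\<forall>m. \<exists>\<omega>>0. \<forall>n. \<forall>t\<in>{0..real m}. norm (f\<^sub>n n t) \<le> \<omega>"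
    and h\<^sub>n_conv: "\<forall>t\<ge>0. weakly_converges (\<lambda>n. h\<^sub>n n t) (h t)"
    and h\<^sub>n_unif: "\<forall>m. \<exists>\<xi>>0. \<forall>n. \<forall>t\<in>{0..real m}. norm (h\<^sub>n n t) \<le> \<xi>"
    and sol: "mixed_solution A S b \<Lambda> \<pi> f h u l"
    and sol\<^sub>n: "\<forall>n. mixed_solution (A\<^sub>n n) (S\<^sub>n n) (b\<^sub>n n) (\<Lambda>\<^sub>n n) \<pi> (f\<^sub>n n) (h\<^sub>n n) (u\<^sub>n n) (l\<^sub>n n)"
  shows "\<forall>t\<ge>0. (\<lambda>n. u\<^sub>n n t) \<longlonglongrightarrow> u t \<and> weakly_converges (\<lambda>n. l\<^sub>n n t) (l t)"
proof (intro allI impI)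
  fix t :: real assume "t \<ge> 0"
  \<comment> \<open>The data are controlled on intervals with integer endpoint, so one such interval
    containing \<open>t\<close> is fixed for all estimates.\<close>
  obtain m :: nat where m: "t \<le> real m" using real_arch_simple by blast
  define T where "T = real m"
  have t: "t \<in> {0..T}" using \<open>t \<ge> 0\<close> m by (simp add: T_def)
  obtain m\<^sub>0 L\<^sub>0 where m\<^sub>0: "m\<^sub>0 > 0" "\<And>n. m\<^sub>n n \<ge> m\<^sub>0" and L\<^sub>0: "L\<^sub>0 > 0" "\<And>n. L\<^sub>n n \<le> L\<^sub>0"
    using A\<^sub>n_unif by blast
  obtain s\<^sub>0 where s\<^sub>0: "s\<^sub>0 > 0" "\<And>n. s\<^sub>n n m \<le> s\<^sub>0" using s\<^sub>n_unif by blast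
  obtain \<alpha>\<^sub>0 M\<^sub>0 where \<alpha>\<^sub>0: "\<alpha>\<^sub>0 > 0" "\<And>n. \<alpha>\<^sub>n n \<ge> \<alpha>\<^sub>0" and M\<^sub>0: "M\<^sub>0 > 0" "\<And>n. M\<^sub>n n \<le> M\<^sub>0"
    using b\<^sub>n_unif by blast
  obtain \<omega> where \<omega>: "\<omega> > 0" "\<And>n \<tau>. \<tau> \<in> {0..T} \<Longrightarrow> norm (f\<^sub>n n \<tau>) \<le> \<omega>"
    using f\<^sub>n_unif unfolding T_def by blast
  obtain \<xi> where \<xi>: "\<xi> > 0" "\<And>n \<tau>. \<tau> \<in> {0..T} \<Longrightarrow> norm (h\<^sub>n n \<tau>) \<le> \<xi>"
    using h\<^sub>n_unif unfolding T_def by blast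
  obtain K\<^sub>\<pi> where K\<^sub>\<pi>: "K\<^sub>\<pi> > 0" "\<And>v. norm (\<pi> v) \<le> norm v * K\<^sub>\<pi>"
    using bounded_linear.pos_bounded[OF \<pi>] by blast
  have sol\<^sub>n': "mixed_solution (A\<^sub>n n) (S\<^sub>n n) (b\<^sub>n n) (\<Lambda>\<^sub>n n) \<pi> (f\<^sub>n n) (h\<^sub>n n) (u\<^sub>n n) (l\<^sub>n n)" for n
    using sol\<^sub>n by blast
  note sd = mixed_solutionD[OF sol]
  note sdn = mixed_solutionD[OF sol\<^sub>n']
  have bb: "bounded_bilinear b" using b by (rule inf_sup_bilinear_bounded_bilinear)
  have bbn: "bounded_bilinear (b\<^sub>n n)" for n using b\<^sub>n inf_sup_bilinear_bounded_bilinear by blast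
  have b\<^sub>n_bound: "\<bar>b\<^sub>n n v \<mu>\<bar> \<le> M\<^sub>0 * norm v * norm \<mu>" for n v \<mu>
  proof -
    have "\<bar>b\<^sub>n n v \<mu>\<bar> \<le> M\<^sub>n n * (norm v * norm \<mu>)"
      using b\<^sub>n unfolding inf_sup_bilinear_def by (metis mult.assoc)
    also have "\<dots> \<le> M\<^sub>0 * (norm v * norm \<mu>)" using M\<^sub>0 by (intro mult_right_mono) auto
    finally show ?thesis by (simp add: mult.assoc)
  qed
  have b\<^sub>n_lim: "(\<lambda>k. b\<^sub>n (r k) (z\<^sub>n k) (\<mu>\<^sub>n k)) \<longlonglongrightarrow> b z \<mu>"
    if "strict_mono r" "weakly_converges z\<^sub>n z" "weakly_converges \<mu>\<^sub>n \<mu>"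
    for r :: "nat \<Rightarrow> nat" and z\<^sub>n z \<mu>\<^sub>n \<mu>
    using b b\<^sub>n that
    by (intro bilinear_tendsto_if_limsup_le[where b\<^sub>n = b\<^sub>n and b = b] b\<^sub>n_limsup)
      (auto simp: inf_sup_bilinear_def)

  \<comment> \<open>Error, remainder and consistency of the operators\<close>
  define d where "d n \<tau> = norm (u\<^sub>n n \<tau> - u \<tau>)" for n \<tau>
  \<comment> \<open>Both operators act on the limit solution \<open>u\<close> here, so
    \<open>P n - p\<close> is a pure consistency error. The remainder \<open>R n\<close> likewise
    contains \<open>S\<^sub>n n u\<close>; the discrepancy to
    \<open>S\<^sub>n n (u\<^sub>n n)\<close> is charged to the integral \<open>I n\<close>.\<close>
  define P where "P n \<tau> = A\<^sub>n n (u \<tau>) + S\<^sub>n n u \<tau>" for n \<tau>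
  define p where "p \<tau> = A (u \<tau>) + S u \<tau>" for \<tau>
  define R where "R n \<tau> = f\<^sub>n n \<tau> \<bullet> \<pi> (u\<^sub>n n \<tau> - u \<tau>) - b\<^sub>n n (u\<^sub>n n \<tau> - u \<tau>) (l\<^sub>n n \<tau>)
      - P n \<tau> \<bullet> (u\<^sub>n n \<tau> - u \<tau>)" for n \<tau>
  define I where "I n \<tau> = integral {0..\<tau>} (d n)" for n \<tau>

  have T_sub: "{0..T} \<subseteq> {0..}" by auto
  have S_in: "S u \<in> cont_Rplus UNIV" and S\<^sub>n_in: "S\<^sub>n n u \<in> cont_Rplus UNIV" for n
    using S S\<^sub>n sd(3) by (auto simp: history_dependent_def)
  have cont_u: "continuous_on {0..T} u" and cont_u\<^sub>n: "continuous_on {0..T} (u\<^sub>n n)"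
    and cont_l\<^sub>n: "continuous_on {0..T} (l\<^sub>n n)" and cont_f\<^sub>n: "continuous_on {0..T} (f\<^sub>n n)"
    and cont_S: "continuous_on {0..T} (S u)" and cont_S\<^sub>n: "continuous_on {0..T} (S\<^sub>n n u)" for n
    using sd(1) sdn(1,2) f\<^sub>n S_in S\<^sub>n_in
    by (auto simp: cont_Rplus_def intro: continuous_on_subset[OF _ T_sub])
  have cont_d: "continuous_on {0..T} (d n)" for n
    unfolding d_def by (intro continuous_intros cont_u cont_u\<^sub>n)
  have cont_p: "continuous_on {0..T} p"
    unfolding p_def
    by (intro continuous_intros strongly_monotone_Lipschitz_continuous_on[OF A] cont_u cont_S)
  have cont_P: "continuous_on {0..T} (P n)" for n
    unfolding P_def
    by (intro continuous_intros strongly_monotone_Lipschitz_continuous_on[OF A\<^sub>n[rule_format]] cont_u cont_S\<^sub>n)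
  have cont_R: "continuous_on {0..T} (R n)" for n
    unfolding R_def
    by (intro continuous_intros bounded_linear.continuous_on[OF \<pi>] bounded_bilinear.continuous_on[OF bbn]
        cont_u cont_u\<^sub>n cont_l\<^sub>n cont_f\<^sub>n cont_P)
  have d_nonneg: "d n \<tau> \<ge> 0" for n \<tau> by (simp add: d_def)
  have I_nonneg: "I n \<tau> \<ge> 0" if "\<tau> \<in> {0..T}" for n \<tau>
    unfolding I_def using that d_nonneg
    by (intro integral_nonneg integrable_continuous_real continuous_on_subset[OF cont_d]) auto

  obtain B\<^sub>u where B\<^sub>u: "B\<^sub>u > 0" "\<And>\<tau>. \<tau> \<in> {0..T} \<Longrightarrow> norm (u \<tau>) \<le> B\<^sub>u"
    using compact_imp_bounded[OF compact_continuous_image[OF cont_u compact_Icc]]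
    unfolding bounded_pos by blast
  obtain B\<^sub>p where B\<^sub>p: "B\<^sub>p > 0" "\<And>\<tau>. \<tau> \<in> {0..T} \<Longrightarrow> norm (p \<tau>) \<le> B\<^sub>p"
    using compact_imp_bounded[OF compact_continuous_image[OF cont_p compact_Icc]]
    unfolding bounded_pos by blast
  obtain F\<^sub>A \<delta>\<^sub>A where F\<^sub>A: "\<And>n v. norm (A\<^sub>n n v - A v) \<le> F\<^sub>A n * (norm v + \<delta>\<^sub>A n)"
    "\<And>n. F\<^sub>A n \<ge> 0" "F\<^sub>A \<longlonglongrightarrow> 0" "bounded (range \<delta>\<^sub>A)"
    using A\<^sub>n_conv by blast
  obtain F\<^sub>S \<delta>\<^sub>S where F\<^sub>S: "\<And>n \<tau>. \<tau> \<in> {0..T} \<Longrightarrow>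
      norm (S\<^sub>n n u \<tau> - S u \<tau>) \<le> F\<^sub>S n * ((SUP r\<in>{0..T}. norm (u r)) + \<delta>\<^sub>S n)"
    "F\<^sub>S \<longlonglongrightarrow> 0" "bounded (range \<delta>\<^sub>S)"
  proof -
    from S\<^sub>n_conv obtain F \<delta> where
      F: "\<forall>n m. F n m \<ge> 0 \<and> \<delta> n m \<ge> 0 \<and>
        (\<forall>v\<in>cont_Rplus UNIV. \<forall>t\<in>{0..real m}.
           norm (S\<^sub>n n v t - S v t) \<le> F n m * ((SUP r\<in>{0..real m}. norm (v r)) + \<delta> n m))"
      "\<forall>m. (\<lambda>n. F n m) \<longlonglongrightarrow> 0 \<and> bounded (range (\<lambda>n. \<delta> n m))"
      by blast
    show thesis
      by (rule that[of "\<lambda>n. F n m" "\<lambda>n. \<delta> n m"]) (use F sd(3) T_def in auto)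
  qed
  \<comment> \<open>Sum of the two consistency errors at the fixed function \<open>u\<close>,
    uniform over \<open>{0..T}\<close>.\<close>
  define G where "G n = F\<^sub>A n * (B\<^sub>u + \<delta>\<^sub>A n) + F\<^sub>S n * ((SUP r\<in>{0..T}. norm (u r)) + \<delta>\<^sub>S n)" for n
  have G: "G \<longlonglongrightarrow> 0"
    unfolding G_def
    by (intro tendsto_add_zero null_times_bounded F\<^sub>A(3,4) F\<^sub>S(2,3))
  have P_G: "norm (P n \<tau> - p \<tau>) \<le> G n" if "\<tau> \<in> {0..T}" for n \<tau>
  proof -
    have "norm (A\<^sub>n n (u \<tau>) - A (u \<tau>)) \<le> F\<^sub>A n * (B\<^sub>u + \<delta>\<^sub>A n)"
      using F\<^sub>A(1,2) B\<^sub>u(2)[OF that] by (meson add_right_mono mult_left_mono order_trans)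
    moreover have "norm (P n \<tau> - p \<tau>) \<le> norm (A\<^sub>n n (u \<tau>) - A (u \<tau>)) + norm (S\<^sub>n n u \<tau> - S u \<tau>)"
      unfolding P_def p_def by (metis add_diff_add norm_triangle_ineq)
    ultimately show ?thesis using F\<^sub>S(1)[OF that, of n] unfolding G_def by linarith
  qed
  have P_lim: "(\<lambda>n. P n \<tau>) \<longlonglongrightarrow> p \<tau>" if "\<tau> \<in> {0..T}" for \<tau>
    by (rule LIM_zero_cancel, rule Lim_null_comparison[OF _ G])
      (use P_G[OF that] in auto)
  obtain B\<^sub>G where B\<^sub>G: "B\<^sub>G > 0" "\<And>n. \<bar>G n\<bar> \<le> B\<^sub>G"
    using convergent_imp_Bseq[OF convergentI[OF G]] unfolding Bseq_def by auto
  \<comment> \<open>Bounds the functional formed by the load \<open>f\<^sub>n\<close> and by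
    \<open>P n\<close>, uniformly in \<open>n\<close> and in time.\<close>
  define K\<^sub>0 where "K\<^sub>0 = \<omega> * K\<^sub>\<pi> + (B\<^sub>p + B\<^sub>G)"
  have K\<^sub>0: "K\<^sub>0 > 0" using \<omega> K\<^sub>\<pi> B\<^sub>p B\<^sub>G by (simp add: K\<^sub>0_def add_pos_pos)
  have P_bound: "norm (P n \<tau>) \<le> B\<^sub>p + B\<^sub>G" if "\<tau> \<in> {0..T}" for n \<tau>
    using P_G[OF that, of n] B\<^sub>p(2)[OF that] B\<^sub>G(2)[of n] norm_triangle_sub[of "P n \<tau>" "p \<tau>"] by linarith
  have f\<pi>_bound: "\<bar>f\<^sub>n n \<tau> \<bullet> \<pi> v\<bar> \<le> \<omega> * K\<^sub>\<pi> * norm v" if "\<tau> \<in> {0..T}" for n \<tau> v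
  proof -
    have "norm (f\<^sub>n n \<tau>) * norm (\<pi> v) \<le> \<omega> * (norm v * K\<^sub>\<pi>)"
      using \<omega> that K\<^sub>\<pi> by (intro mult_mono) auto
    with Cauchy_Schwarz_ineq2[of "f\<^sub>n n \<tau>" "\<pi> v"] show ?thesis by (simp add: mult_ac)
  qed
  have P_inner: "\<bar>P n \<tau> \<bullet> v\<bar> \<le> (B\<^sub>p + B\<^sub>G) * norm v" if "\<tau> \<in> {0..T}" for n \<tau> v
    using order_trans[OF Cauchy_Schwarz_ineq2 mult_right_mono[OF P_bound[OF that] norm_ge_zero]] .
  have data_bound: "\<bar>f\<^sub>n n \<tau> \<bullet> \<pi> v\<bar> + \<bar>P n \<tau> \<bullet> v\<bar> \<le> K\<^sub>0 * norm v" if "\<tau> \<in> {0..T}" for n \<tau> v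
    using f\<pi>_bound[OF that, of n v] P_inner[OF that, of n v] unfolding K\<^sub>0_def
    by (simp add: algebra_simps)

  have S\<^sub>n_diff: "norm (S\<^sub>n n (u\<^sub>n n) \<tau> - S\<^sub>n n u \<tau>) \<le> s\<^sub>0 * I n \<tau>" if "\<tau> \<in> {0..T}" for n \<tau>
  proof -
    have "norm (S\<^sub>n n (u\<^sub>n n) \<tau> - S\<^sub>n n u \<tau>) \<le> s\<^sub>n n m * I n \<tau>"
      using S\<^sub>n sdn(3) sd(3) that unfolding history_dependent_def T_def I_def d_def by blast
    also have "\<dots> \<le> s\<^sub>0 * I n \<tau>" using s\<^sub>0 I_nonneg[OF that] by (intro mult_right_mono)
    finally show ?thesis .
  qed
  have A\<^sub>n_diff: "norm (A\<^sub>n n (u\<^sub>n n \<tau>) - A\<^sub>n n (u \<tau>)) \<le> L\<^sub>0 * d n \<tau>" for n \<tau>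
  proof -
    have "norm (A\<^sub>n n (u\<^sub>n n \<tau>) - A\<^sub>n n (u \<tau>)) \<le> L\<^sub>n n * d n \<tau>"
      using A\<^sub>n unfolding strongly_monotone_Lipschitz_def d_def by blast
    also have "\<dots> \<le> L\<^sub>0 * d n \<tau>" using L\<^sub>0 d_nonneg by (intro mult_right_mono)
    finally show ?thesis .
  qed
  have energy: "m\<^sub>0 * (d n \<tau>)\<^sup>2 \<le> s\<^sub>0 * I n \<tau> * d n \<tau> + R n \<tau>" if "\<tau> \<in> {0..T}" for n \<tau>
  proof -
    have "m\<^sub>0 * (d n \<tau>)\<^sup>2 \<le> m\<^sub>n n * (d n \<tau>)\<^sup>2" using m\<^sub>0 by (intro mult_right_mono) auto
    also have "\<dots> \<le> f\<^sub>n n \<tau> \<bullet> \<pi> (u\<^sub>n n \<tau> - u \<tau>) - b\<^sub>n n (u\<^sub>n n \<tau> - u \<tau>) (l\<^sub>n n \<tau>)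
        - (A\<^sub>n n (u \<tau>) + S\<^sub>n n (u\<^sub>n n) \<tau>) \<bullet> (u\<^sub>n n \<tau> - u \<tau>)"
      unfolding d_def using that A\<^sub>n sdn(5) by (intro energy_estimate) auto
    \<comment> \<open>Exchanging the history of \<open>u\<^sub>n\<close> for that of
      \<open>u\<close> leaves one term, which the history estimate bounds by
      \<open>s\<^sub>0 * I n \<tau> * d n \<tau>\<close>.\<close>
    also have "\<dots> = R n \<tau> - (S\<^sub>n n (u\<^sub>n n) \<tau> - S\<^sub>n n u \<tau>) \<bullet> (u\<^sub>n n \<tau> - u \<tau>)"
      unfolding R_def P_def by (simp add: inner_add_left inner_diff_left)
    also have "\<dots> \<le> R n \<tau> + s\<^sub>0 * I n \<tau> * d n \<tau>"
      using order_trans[OF Cauchy_Schwarz_ineq2 mult_right_mono[OF S\<^sub>n_diff[OF that] norm_ge_zero],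
          of n "u\<^sub>n n \<tau> - u \<tau>"]
      unfolding d_def by linarith
    finally show ?thesis by simp
  qed

  \<comment> \<open>A priori bounds\<close>
  have l\<^sub>n_bound: "\<alpha>\<^sub>0 * norm (l\<^sub>n n \<tau>) \<le> K\<^sub>0 + L\<^sub>0 * d n \<tau> + s\<^sub>0 * I n \<tau>" if \<tau>: "\<tau> \<in> {0..T}" for n \<tau>
  proof -
    have "\<alpha>\<^sub>n n * norm (l\<^sub>n n \<tau>) \<le> K\<^sub>0 + L\<^sub>0 * d n \<tau> + s\<^sub>0 * I n \<tau>"
    proof (rule inf_sup_bilinear_norm_le[OF b\<^sub>n[rule_format]])
      show "0 \<le> K\<^sub>0 + L\<^sub>0 * d n \<tau> + s\<^sub>0 * I n \<tau>"
        using K\<^sub>0 L\<^sub>0 s\<^sub>0 d_nonneg I_nonneg[OF \<tau>] by (simp add: add_nonneg_nonneg)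
      fix v
      \<comment> \<open>The equation is solved for the multiplier term and expanded around
        \<open>u\<close>, so that the inf-sup condition bounds the multiplier by \<open>d\<close>
        and \<open>I\<close>.\<close>
      have "b\<^sub>n n v (l\<^sub>n n \<tau>) = f\<^sub>n n \<tau> \<bullet> \<pi> v - P n \<tau> \<bullet> v
          - (A\<^sub>n n (u\<^sub>n n \<tau>) - A\<^sub>n n (u \<tau>)) \<bullet> v - (S\<^sub>n n (u\<^sub>n n) \<tau> - S\<^sub>n n u \<tau>) \<bullet> v"
        using sdn(5)[of \<tau> n v] \<tau> unfolding P_def by (simp add: inner_add_left inner_diff_left)
      moreover have "\<bar>(A\<^sub>n n (u\<^sub>n n \<tau>) - A\<^sub>n n (u \<tau>)) \<bullet> v\<bar> \<le> L\<^sub>0 * d n \<tau> * norm v"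
        using order_trans[OF Cauchy_Schwarz_ineq2 mult_right_mono[OF A\<^sub>n_diff norm_ge_zero]] .
      moreover have "\<bar>(S\<^sub>n n (u\<^sub>n n) \<tau> - S\<^sub>n n u \<tau>) \<bullet> v\<bar> \<le> s\<^sub>0 * I n \<tau> * norm v"
        using order_trans[OF Cauchy_Schwarz_ineq2 mult_right_mono[OF S\<^sub>n_diff[OF \<tau>] norm_ge_zero]] .
      ultimately have "\<bar>b\<^sub>n n v (l\<^sub>n n \<tau>)\<bar> \<le> K\<^sub>0 * norm v + L\<^sub>0 * d n \<tau> * norm v + s\<^sub>0 * I n \<tau> * norm v"
        using data_bound[OF \<tau>, of n v] by linarith
      then show "\<bar>b\<^sub>n n v (l\<^sub>n n \<tau>)\<bar> \<le> (K\<^sub>0 + L\<^sub>0 * d n \<tau> + s\<^sub>0 * I n \<tau>) * norm v"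
        by (simp add: algebra_simps)
    qed
    moreover have "\<alpha>\<^sub>0 * norm (l\<^sub>n n \<tau>) \<le> \<alpha>\<^sub>n n * norm (l\<^sub>n n \<tau>)"
      using \<alpha>\<^sub>0 by (intro mult_right_mono) auto
    ultimately show ?thesis by simp
  qed

  \<comment> \<open>\<open>N\<close> converts the factor
    \<open>M\<^sub>0 * (\<xi> + B\<^sub>u)\<close> of the multiplier norm into a factor of
    \<open>\<alpha>\<^sub>0 * norm (l\<^sub>n n \<tau>)\<close>. \<open>E\<close> dominates
    \<open>K\<^sub>0\<close>, \<open>L\<^sub>0\<close> and \<open>s\<^sub>0\<close> at once, and
    \<open>C\<close> is the resulting constant after division by \<open>m\<^sub>0\<close>.\<close>
  define N where "N = M\<^sub>0 * (\<xi> + B\<^sub>u) / \<alpha>\<^sub>0"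
  define E where "E = K\<^sub>0 + L\<^sub>0 + s\<^sub>0"
  define C where "C = E * (1 + N) / m\<^sub>0"
  have pos: "N > 0" "E > 0" using M\<^sub>0 \<xi> B\<^sub>u \<alpha>\<^sub>0 K\<^sub>0 L\<^sub>0 s\<^sub>0 by (auto simp: N_def E_def add_pos_pos)
  then have C: "C > 0" using m\<^sub>0 by (simp add: C_def)
  have d_linear: "d n \<tau> \<le> (1 + 2 * C) * integral {0..\<tau>} (d n) + (1 + 2 * C)" if \<tau>: "\<tau> \<in> {0..T}" for n \<tau>
  proof -
    let ?x = "d n \<tau>" and ?i = "I n \<tau>"
    have i: "?i \<ge> 0" using I_nonneg[OF \<tau>] .
    \<comment> \<open>Testing with 0 replaces \<open>u\<^sub>n\<close> by the bounded
      \<open>h\<^sub>n\<close> in the coupling term. Otherwise a product of \<open>d\<close> with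
      the multiplier norm would remain, quadratic in \<open>d\<close> with an uncontrolled
      constant.\<close>
    have "b\<^sub>n n (u\<^sub>n n \<tau>) (0 - l\<^sub>n n \<tau>) \<le> b\<^sub>n n (h\<^sub>n n \<tau>) (0 - l\<^sub>n n \<tau>)"
      using sdn(6)[of \<tau> 0 n] \<tau> \<Lambda>\<^sub>n by auto
    then have "b\<^sub>n n (h\<^sub>n n \<tau>) (l\<^sub>n n \<tau>) \<le> b\<^sub>n n (u\<^sub>n n \<tau>) (l\<^sub>n n \<tau>)"
      by (simp add: bounded_bilinear.minus_right[OF bbn])
    moreover have "b\<^sub>n n (u\<^sub>n n \<tau> - u \<tau>) (l\<^sub>n n \<tau>) = b\<^sub>n n (u\<^sub>n n \<tau>) (l\<^sub>n n \<tau>) - b\<^sub>n n (u \<tau>) (l\<^sub>n n \<tau>)"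
      by (rule bounded_bilinear.diff_left[OF bbn])
    moreover have "\<bar>b\<^sub>n n (h\<^sub>n n \<tau>) (l\<^sub>n n \<tau>)\<bar> \<le> M\<^sub>0 * \<xi> * norm (l\<^sub>n n \<tau>)"
      using \<xi>(2)[OF \<tau>] M\<^sub>0
      by (intro order_trans[OF b\<^sub>n_bound] mult_right_mono mult_left_mono) auto
    moreover have "\<bar>b\<^sub>n n (u \<tau>) (l\<^sub>n n \<tau>)\<bar> \<le> M\<^sub>0 * B\<^sub>u * norm (l\<^sub>n n \<tau>)"
      using B\<^sub>u(2)[OF \<tau>] M\<^sub>0
      by (intro order_trans[OF b\<^sub>n_bound] mult_right_mono mult_left_mono) auto
    ultimately have "R n \<tau> \<le> K\<^sub>0 * ?x + M\<^sub>0 * (\<xi> + B\<^sub>u) * norm (l\<^sub>n n \<tau>)"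
      using data_bound[OF \<tau>, of n "u\<^sub>n n \<tau> - u \<tau>"] unfolding R_def d_def
      by (simp add: algebra_simps)
    also have "M\<^sub>0 * (\<xi> + B\<^sub>u) * norm (l\<^sub>n n \<tau>) = N * (\<alpha>\<^sub>0 * norm (l\<^sub>n n \<tau>))"
      using \<alpha>\<^sub>0 by (simp add: N_def)
    also have "\<dots> \<le> N * (K\<^sub>0 + L\<^sub>0 * ?x + s\<^sub>0 * ?i)"
      using l\<^sub>n_bound[OF \<tau>] pos by (intro mult_left_mono) auto
    finally have "m\<^sub>0 * ?x\<^sup>2 \<le> (s\<^sub>0 * ?i * ?x + K\<^sub>0 * ?x) + N * (K\<^sub>0 + L\<^sub>0 * ?x + s\<^sub>0 * ?i)"
      using energy[OF \<tau>, of n] by linarith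
    also have "\<dots> \<le> E * ((1 + ?i) * (1 + ?x)) + N * (E * ((1 + ?i) * (1 + ?x)))"
    proof (intro add_mono mult_left_mono)
      have "0 \<le> K\<^sub>0 * ?x" "0 \<le> K\<^sub>0 * ?i" "0 \<le> K\<^sub>0 * (?i * ?x)" "0 \<le> s\<^sub>0 * ?x" "0 \<le> s\<^sub>0 * ?i" "0 \<le> s\<^sub>0 * (?i * ?x)"
        "0 \<le> L\<^sub>0 * ?x" "0 \<le> L\<^sub>0 * ?i" "0 \<le> L\<^sub>0 * (?i * ?x)"
        using i d_nonneg[of n \<tau>] K\<^sub>0 L\<^sub>0 s\<^sub>0 by auto
      then show "s\<^sub>0 * ?i * ?x + K\<^sub>0 * ?x \<le> E * ((1 + ?i) * (1 + ?x))"
        and "K\<^sub>0 + L\<^sub>0 * ?x + s\<^sub>0 * ?i \<le> E * ((1 + ?i) * (1 + ?x))"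
        using K\<^sub>0 L\<^sub>0 s\<^sub>0 unfolding E_def by (simp_all add: algebra_simps)
    qed (use pos in auto)
    also have "\<dots> = m\<^sub>0 * (C * (1 + ?i) * (1 + ?x))"
      using m\<^sub>0 by (simp add: C_def field_simps)
    finally have "?x\<^sup>2 \<le> C * (1 + ?i) * (1 + ?x)" using m\<^sub>0 by simp
    \<comment> \<open>The quadratic inequality becomes a bound affine in the integral of
      \<open>d\<close>, the form that Gronwall requires.\<close>
    then have "?x \<le> 1 + 2 * (C * (1 + ?i))"
      by (rule quadratic_le_imp_le) (use C i d_nonneg in auto)
    then show ?thesis using i unfolding I_def by (simp add: algebra_simps)
  qed

  \<comment> \<open>The bounds come in a chain, all uniform in \<open>n\<close>: Gronwall with
    constant forcing bounds \<open>I\<close>, then \<open>d_linear\<close> bounds \<open>d\<close>,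
    then \<open>l\<^sub>n_bound\<close> bounds the multipliers.\<close>
  obtain B\<^sub>I where B\<^sub>I: "\<And>n \<tau>. \<tau> \<in> {0..T} \<Longrightarrow> I n \<tau> \<le> B\<^sub>I"
  proof
    show "I n \<tau> \<le> exp ((1 + 2 * C) * T) * integral {0..T} (\<lambda>_. 1 + 2 * C)" if "\<tau> \<in> {0..T}" for n \<tau>
      unfolding I_def
      by (rule Gronwall_integral[OF cont_d continuous_on_const _ _ d_linear that]) (use C in auto)
  qed
  obtain B\<^sub>d where B\<^sub>d: "\<And>n \<tau>. \<tau> \<in> {0..T} \<Longrightarrow> d n \<tau> \<le> B\<^sub>d"
  proof
    fix n \<tau> assume "\<tau> \<in> {0..T}"
    from d_linear[OF this, of n] mult_left_mono[OF B\<^sub>I[OF this, of n], of "1 + 2 * C"] C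
    show "d n \<tau> \<le> (1 + 2 * C) * B\<^sub>I + (1 + 2 * C)" unfolding I_def by linarith
  qed
  obtain B\<^sub>l where B\<^sub>l: "\<And>n \<tau>. \<tau> \<in> {0..T} \<Longrightarrow> norm (l\<^sub>n n \<tau>) \<le> B\<^sub>l"
  proof
    fix n \<tau> assume \<tau>: "\<tau> \<in> {0..T}"
    have "\<alpha>\<^sub>0 * norm (l\<^sub>n n \<tau>) \<le> K\<^sub>0 + L\<^sub>0 * B\<^sub>d + s\<^sub>0 * B\<^sub>I"
      using l\<^sub>n_bound[OF \<tau>, of n] mult_left_mono[OF B\<^sub>I[OF \<tau>, of n], of s\<^sub>0]
        mult_left_mono[OF B\<^sub>d[OF \<tau>, of n], of L\<^sub>0] s\<^sub>0 L\<^sub>0 by linarith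
    then show "norm (l\<^sub>n n \<tau>) \<le> (K\<^sub>0 + L\<^sub>0 * B\<^sub>d + s\<^sub>0 * B\<^sub>I) / \<alpha>\<^sub>0"
      using \<alpha>\<^sub>0 by (simp add: field_simps)
  qed
  have B_nonneg: "B\<^sub>d \<ge> 0" "B\<^sub>l \<ge> 0"
    using B\<^sub>d[OF t, of 0] B\<^sub>l[OF t, of 0] d_nonneg[of 0 t] norm_ge_zero[of "l\<^sub>n 0 t"] by linarith+
  \<comment> \<open>An upper bound is enough, since domination is required of the positive part of
    \<open>R\<close> only.\<close>
  have R_bound: "R n \<tau> \<le> K\<^sub>0 * B\<^sub>d + M\<^sub>0 * B\<^sub>d * B\<^sub>l" if \<tau>: "\<tau> \<in> {0..T}" for n \<tau>
  proof -
    have "M\<^sub>0 * norm (u\<^sub>n n \<tau> - u \<tau>) * norm (l\<^sub>n n \<tau>) \<le> M\<^sub>0 * B\<^sub>d * B\<^sub>l"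
      using B\<^sub>d[OF \<tau>, of n] B\<^sub>l[OF \<tau>, of n] B_nonneg M\<^sub>0 unfolding d_def by (intro mult_mono) auto
    with b\<^sub>n_bound[of n "u\<^sub>n n \<tau> - u \<tau>" "l\<^sub>n n \<tau>"]
    have "- b\<^sub>n n (u\<^sub>n n \<tau> - u \<tau>) (l\<^sub>n n \<tau>) \<le> M\<^sub>0 * B\<^sub>d * B\<^sub>l" by linarith
    moreover have "K\<^sub>0 * norm (u\<^sub>n n \<tau> - u \<tau>) \<le> K\<^sub>0 * B\<^sub>d"
      using B\<^sub>d[OF \<tau>, of n] K\<^sub>0 unfolding d_def by simp
    ultimately show ?thesis using data_bound[OF \<tau>, of n "u\<^sub>n n \<tau> - u \<tau>"] unfolding R_def by linarith
  qed

  \<comment> \<open>The remainder at weak cluster points\<close>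
  have weak_subseq: "\<exists>q \<mu> v. strict_mono q \<and> weakly_converges (\<lambda>k. u\<^sub>n (r (q k)) \<tau>) v \<and>
      weakly_converges (\<lambda>k. l\<^sub>n (r (q k)) \<tau>) \<mu>"
    if \<tau>: "\<tau> \<in> {0..T}" for \<tau> and r :: "nat \<Rightarrow> nat"
  proof -
    \<comment> \<open>Compactness is applied to pairs in the product Hilbert space, which gives both
      weak limits along one \<open>q\<close>.\<close>
    have bd: "norm (u\<^sub>n (r k) \<tau>, l\<^sub>n (r k) \<tau>) \<le> (B\<^sub>d + B\<^sub>u) + B\<^sub>l" for k
      using norm_Pair_le[of "u\<^sub>n (r k) \<tau>" "l\<^sub>n (r k) \<tau>"] B\<^sub>l[OF \<tau>, of "r k"] B\<^sub>d[OF \<tau>, of "r k"] B\<^sub>u(2)[OF \<tau>]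
        norm_triangle_sub[of "u\<^sub>n (r k) \<tau>" "u \<tau>"] unfolding d_def by linarith
    obtain q x where q: "strict_mono q"
      and x: "weakly_converges (\<lambda>k. (u\<^sub>n (r (q k)) \<tau>, l\<^sub>n (r (q k)) \<tau>)) x"
      by (rule bounded_sequence_weakly_convergent_subsequence[OF bd])
    from weakly_converges_bounded_linear[OF x bounded_linear_fst]
    have "weakly_converges (\<lambda>k. u\<^sub>n (r (q k)) \<tau>) (fst x)" by simp
    moreover from weakly_converges_bounded_linear[OF x bounded_linear_snd]
    have "weakly_converges (\<lambda>k. l\<^sub>n (r (q k)) \<tau>) (snd x)" by simp
    ultimately show ?thesis using q by blast
  qed

  \<comment> \<open>Compactness yields limits only along further subsequences; since they are always
    0, the whole sequence converges.\<close>
  have R_lim: "(\<lambda>n. max (R n \<tau>) 0) \<longlonglongrightarrow> 0" if \<tau>: "\<tau> \<in> {0..T}" for \<tau>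
  proof (rule LIMSEQ_if_subseq)
    fix r :: "nat \<Rightarrow> nat" assume r: "strict_mono r"
    obtain q \<mu> v where q: "strict_mono q" and v: "weakly_converges (\<lambda>k. u\<^sub>n (r (q k)) \<tau>) v"
      and \<mu>: "weakly_converges (\<lambda>k. l\<^sub>n (r (q k)) \<tau>) \<mu>"
      using weak_subseq[OF \<tau>] by blast
    define \<rho> where "\<rho> = r \<circ> q"
    have \<rho>: "strict_mono \<rho>" unfolding \<rho>_def using r q by (rule strict_mono_o)
    have v: "weakly_converges (\<lambda>k. u\<^sub>n (\<rho> k) \<tau>) v" and \<mu>: "weakly_converges (\<lambda>k. l\<^sub>n (\<rho> k) \<tau>) \<mu>"
      using v \<mu> by (simp_all add: \<rho>_def)
    have dv: "weakly_converges (\<lambda>k. u\<^sub>n (\<rho> k) \<tau> - u \<tau>) (v - u \<tau>)"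
      using v tendsto_imp_weakly_converges[OF tendsto_const] by (rule weakly_converges_diff)
    have "\<tau> \<ge> 0" using \<tau> by simp
    have "\<mu> \<in> \<Lambda>"
    proof -
      have "strict_mono \<rho> \<and> (\<forall>k. l\<^sub>n (\<rho> k) \<tau> \<in> \<Lambda>\<^sub>n (\<rho> k)) \<and> weakly_converges (\<lambda>k. l\<^sub>n (\<rho> k) \<tau>) \<mu>"
        using \<rho> \<mu> sdn(4)[OF \<open>\<tau> \<ge> 0\<close>] by blast
      with \<Lambda>\<^sub>n_Mosco show ?thesis
        unfolding Mosco_converges_def by (elim conjE allE[of _ \<rho>]) fast
    qed
    have ineq: "b v (l \<tau> - \<mu>) \<le> b (h \<tau>) (l \<tau> - \<mu>)"
    proof -
      \<comment> \<open>A Mosco recovery sequence for \<open>l \<tau>\<close> is admissible in the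
        approximate inequalities, both sides of which then converge.\<close>
      obtain \<mu>\<^sub>n where \<mu>\<^sub>n: "\<And>n. \<mu>\<^sub>n n \<in> \<Lambda>\<^sub>n n" "\<mu>\<^sub>n \<longlonglongrightarrow> l \<tau>"
        using \<Lambda>\<^sub>n_Mosco sd(4)[OF \<open>\<tau> \<ge> 0\<close>] unfolding Mosco_converges_def by blast
      have w: "weakly_converges (\<lambda>k. \<mu>\<^sub>n (\<rho> k) - l\<^sub>n (\<rho> k) \<tau>) (l \<tau> - \<mu>)"
        by (intro weakly_converges_diff \<mu> weakly_converges_subseq[OF _ \<rho>]
            tendsto_imp_weakly_converges \<mu>\<^sub>n)
      have hw: "weakly_converges (\<lambda>k. h\<^sub>n (\<rho> k) \<tau>) (h \<tau>)"
        using h\<^sub>n_conv \<open>\<tau> \<ge> 0\<close> weakly_converges_subseq[OF _ \<rho>] by blast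
      show ?thesis
        by (rule LIMSEQ_le[OF b\<^sub>n_lim[OF \<rho> v w] b\<^sub>n_lim[OF \<rho> hw w]])
          (use sdn(6)[OF \<open>\<tau> \<ge> 0\<close> \<mu>\<^sub>n(1)] in blast)
    qed
    have "(\<lambda>k. R (\<rho> k) \<tau>) \<longlonglongrightarrow> f \<tau> \<bullet> \<pi> (v - u \<tau>) - b (v - u \<tau>) \<mu> - p \<tau> \<bullet> (v - u \<tau>)"
      unfolding R_def
    proof (intro tendsto_diff)
      show "(\<lambda>k. f\<^sub>n (\<rho> k) \<tau> \<bullet> \<pi> (u\<^sub>n (\<rho> k) \<tau> - u \<tau>)) \<longlonglongrightarrow> f \<tau> \<bullet> \<pi> (v - u \<tau>)"
      proof (rule weak_strong_inner)
        show "weakly_converges (\<lambda>k. f\<^sub>n (\<rho> k) \<tau>) (f \<tau>)"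
          using f\<^sub>n_conv \<open>\<tau> \<ge> 0\<close> weakly_converges_subseq[OF _ \<rho>] by blast
        show "norm (f\<^sub>n (\<rho> k) \<tau>) \<le> \<omega>" for k using \<omega>(2)[OF \<tau>] .
        show "(\<lambda>k. \<pi> (u\<^sub>n (\<rho> k) \<tau> - u \<tau>)) \<longlonglongrightarrow> \<pi> (v - u \<tau>)" using dv by (rule \<pi>_weak_strong)
      qed
      show "(\<lambda>k. b\<^sub>n (\<rho> k) (u\<^sub>n (\<rho> k) \<tau> - u \<tau>) (l\<^sub>n (\<rho> k) \<tau>)) \<longlonglongrightarrow> b (v - u \<tau>) \<mu>"
        using b\<^sub>n_lim[OF \<rho> dv \<mu>] .
      have "(\<lambda>k. (u\<^sub>n (\<rho> k) \<tau> - u \<tau>) \<bullet> P (\<rho> k) \<tau>) \<longlonglongrightarrow> (v - u \<tau>) \<bullet> p \<tau>"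
      proof (rule weak_strong_inner[OF dv])
        show "norm (u\<^sub>n (\<rho> k) \<tau> - u \<tau>) \<le> B\<^sub>d" for k using B\<^sub>d[OF \<tau>] unfolding d_def .
        show "(\<lambda>k. P (\<rho> k) \<tau>) \<longlonglongrightarrow> p \<tau>"
          using LIMSEQ_subseq_LIMSEQ[OF P_lim[OF \<tau>] \<rho>] by (simp add: comp_def)
      qed
      then show "(\<lambda>k. P (\<rho> k) \<tau> \<bullet> (u\<^sub>n (\<rho> k) \<tau> - u \<tau>)) \<longlonglongrightarrow> p \<tau> \<bullet> (v - u \<tau>)"
        by (simp add: inner_commute)
    qed
    \<comment> \<open>The limit of \<open>R\<close> may be strictly negative, hence the passage to
      positive parts.\<close>
    from tendsto_max[OF this tendsto_const[of 0]]
    have "(\<lambda>k. max (R (\<rho> k) \<tau>) 0)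
      \<longlonglongrightarrow> max (f \<tau> \<bullet> \<pi> (v - u \<tau>) - b (v - u \<tau>) \<mu> - p \<tau> \<bullet> (v - u \<tau>)) 0" .
    \<comment> \<open>The limit equation reduces the expression to
      \<open>b (v - u \<tau>) (l \<tau> - \<mu>)\<close>. Adding the two inequalities cancels the
      terms with \<open>h\<close> and gives its sign.\<close>
    moreover have "f \<tau> \<bullet> \<pi> (v - u \<tau>) - b (v - u \<tau>) \<mu> - p \<tau> \<bullet> (v - u \<tau>) \<le> 0"
    proof -
      have "f \<tau> \<bullet> \<pi> (v - u \<tau>) = p \<tau> \<bullet> (v - u \<tau>) + b (v - u \<tau>) (l \<tau>)"
        using sd(5)[OF \<open>\<tau> \<ge> 0\<close>, of "v - u \<tau>"] by (simp add: p_def inner_add_left)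
      moreover have "b (u \<tau>) (\<mu> - l \<tau>) \<le> b (h \<tau>) (\<mu> - l \<tau>)"
        using sd(6)[OF \<open>\<tau> \<ge> 0\<close> \<open>\<mu> \<in> \<Lambda>\<close>] .
      ultimately show ?thesis using ineq
        by (simp add: bounded_bilinear.diff_left[OF bb] bounded_bilinear.diff_right[OF bb])
    qed
    ultimately have "(\<lambda>k. max (R (r (q k)) \<tau>) 0) \<longlonglongrightarrow> 0" by (simp add: \<rho>_def max_absorb2)
    with q show "\<exists>q. strict_mono q \<and> (\<lambda>k. max (R (r (q k)) \<tau>) 0) \<longlonglongrightarrow> 0" by blast
  qed

  \<comment> \<open>Strong convergence of the solutions \<open>u\<^sub>n\<close>\<close>
  define g where "g n \<tau> = sqrt (max (R n \<tau>) 0 / m\<^sub>0)" for n \<tau>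
  define B\<^sub>R where "B\<^sub>R = K\<^sub>0 * B\<^sub>d + M\<^sub>0 * B\<^sub>d * B\<^sub>l"
  have "B\<^sub>R \<ge> 0" using K\<^sub>0 M\<^sub>0 B_nonneg by (simp add: B\<^sub>R_def)
  have d_le_g: "d n \<tau> \<le> (s\<^sub>0 / m\<^sub>0) * integral {0..\<tau>} (d n) + g n \<tau>" if \<tau>: "\<tau> \<in> {0..T}" for n \<tau>
  proof -
    \<comment> \<open>The positive part makes the constant term of the quadratic nonnegative, as
      \<open>quadratic_le_imp_le_sqrt\<close> demands; after division by \<open>m\<^sub>0\<close>
      its root is \<open>g\<close>.\<close>
    have "m\<^sub>0 * (d n \<tau>)\<^sup>2 \<le> s\<^sub>0 * I n \<tau> * d n \<tau> + max (R n \<tau>) 0"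
      using energy[OF \<tau>, of n] by linarith
    then have "(d n \<tau>)\<^sup>2 \<le> (s\<^sub>0 / m\<^sub>0 * I n \<tau>) * d n \<tau> + max (R n \<tau>) 0 / m\<^sub>0"
      using m\<^sub>0 by (simp add: field_simps)
    then show ?thesis
      unfolding g_def I_def[symmetric]
      by (rule quadratic_le_imp_le_sqrt) (use s\<^sub>0 m\<^sub>0 I_nonneg[OF \<tau>] in auto)
  qed
  have g_cont: "continuous_on {0..T} (g n)" for n
    unfolding g_def using m\<^sub>0 by (intro continuous_intros cont_R) auto
  have g_bound: "0 \<le> g n \<tau> \<and> g n \<tau> \<le> sqrt (B\<^sub>R / m\<^sub>0)" if "\<tau> \<in> {0..T}" for n \<tau>
    using R_bound[OF that, of n] m\<^sub>0 \<open>B\<^sub>R \<ge> 0\<close> unfolding g_def B\<^sub>R_def[symmetric]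
    by (simp add: divide_right_mono)
  have g_lim: "(\<lambda>n. g n \<tau>) \<longlonglongrightarrow> 0" if "\<tau> \<in> {0..T}" for \<tau>
    using tendsto_real_sqrt[OF tendsto_divide_zero[OF R_lim[OF that], of m\<^sub>0]] unfolding g_def by simp
  note null = Gronwall_null_sequence[OF cont_d d_nonneg g_cont g_bound g_lim _ d_le_g t]
  have I_lim: "(\<lambda>n. I n t) \<longlonglongrightarrow> 0" unfolding I_def using null(1) s\<^sub>0 m\<^sub>0 by auto
  have d_lim: "(\<lambda>n. d n t) \<longlonglongrightarrow> 0" using null(2) s\<^sub>0 m\<^sub>0 by auto
  have u_lim: "(\<lambda>n. u\<^sub>n n t) \<longlonglongrightarrow> u t"
    using d_lim unfolding d_def by (simp add: tendsto_norm_zero_iff LIM_zero_iff)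

  \<comment> \<open>Weak convergence of the multipliers\<close>
  have AS_lim: "(\<lambda>n. A\<^sub>n n (u\<^sub>n n t) + S\<^sub>n n (u\<^sub>n n) t) \<longlonglongrightarrow> p t"
  proof -
    have "(\<lambda>n. A\<^sub>n n (u\<^sub>n n t) - A\<^sub>n n (u t)) \<longlonglongrightarrow> 0"
      by (rule Lim_null_comparison[OF _ tendsto_mult_right_zero[OF d_lim, of L\<^sub>0]]) (use A\<^sub>n_diff in auto)
    moreover have "(\<lambda>n. S\<^sub>n n (u\<^sub>n n) t - S\<^sub>n n u t) \<longlonglongrightarrow> 0"
      by (rule Lim_null_comparison[OF _ tendsto_mult_right_zero[OF I_lim, of s\<^sub>0]]) (use S\<^sub>n_diff[OF t] in auto)
    \<comment> \<open>The operators are expanded around \<open>u\<close>: \<open>P n t\<close>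
      converges by consistency, and the corrections vanish with \<open>d\<close> and
      \<open>I\<close>.\<close>
    ultimately have "(\<lambda>n. P n t + ((A\<^sub>n n (u\<^sub>n n t) - A\<^sub>n n (u t)) + (S\<^sub>n n (u\<^sub>n n) t - S\<^sub>n n u t)))
        \<longlonglongrightarrow> p t + (0 + 0)"
      by (intro tendsto_add P_lim t)
    then show ?thesis by (simp add: P_def algebra_simps)
  qed
  have "weakly_converges (\<lambda>n. l\<^sub>n n t) (l t)"
    unfolding weakly_converges_def
  proof (intro allI impI LIMSEQ_if_subseq)
    fix \<phi> :: "'y \<Rightarrow> real" and r :: "nat \<Rightarrow> nat" assume \<phi>: "bounded_linear \<phi>" and r: "strict_mono r"
    obtain q \<mu> where q: "strict_mono q" and \<mu>: "weakly_converges (\<lambda>k. l\<^sub>n (r (q k)) t) \<mu>"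
      using weak_subseq[OF t] by blast
    have \<rho>: "strict_mono (\<lambda>k. r (q k))" using strict_mono_o[OF r q] by (simp add: comp_def)
    have "b v (\<mu> - l t) = 0" for v
    proof -
      have "(\<lambda>n. f\<^sub>n n t \<bullet> \<pi> v - (A\<^sub>n n (u\<^sub>n n t) + S\<^sub>n n (u\<^sub>n n) t) \<bullet> v) \<longlonglongrightarrow> f t \<bullet> \<pi> v - p t \<bullet> v"
        using f\<^sub>n_conv \<open>t \<ge> 0\<close> by (intro tendsto_intros AS_lim weakly_converges_inner) auto
      moreover have "b\<^sub>n n v (l\<^sub>n n t) = f\<^sub>n n t \<bullet> \<pi> v - (A\<^sub>n n (u\<^sub>n n t) + S\<^sub>n n (u\<^sub>n n) t) \<bullet> v" for n
        using sdn(5)[OF \<open>t \<ge> 0\<close>, of n v] by (simp add: inner_add_left)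
      moreover have "f t \<bullet> \<pi> v - p t \<bullet> v = b v (l t)"
        using sd(5)[OF \<open>t \<ge> 0\<close>, of v] by (simp add: p_def inner_add_left)
      ultimately have "(\<lambda>n. b\<^sub>n n v (l\<^sub>n n t)) \<longlonglongrightarrow> b v (l t)" by simp
      from LIMSEQ_subseq_LIMSEQ[OF this \<rho>] have "(\<lambda>k. b\<^sub>n (r (q k)) v (l\<^sub>n (r (q k)) t)) \<longlonglongrightarrow> b v (l t)"
        by (simp add: comp_def)
      \<comment> \<open>The constant sequence \<open>v\<close> is weakly convergent, so the limit of
        the forms applies to it.\<close>
      moreover have "(\<lambda>k. b\<^sub>n (r (q k)) v (l\<^sub>n (r (q k)) t)) \<longlonglongrightarrow> b v \<mu>"
        by (rule b\<^sub>n_lim[OF \<rho> tendsto_imp_weakly_converges[OF tendsto_const] \<mu>])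
      ultimately have "b v \<mu> = b v (l t)" using LIMSEQ_unique by blast
      then show ?thesis by (simp add: bounded_bilinear.diff_right[OF bb])
    qed
    \<comment> \<open>With bound 0 the inf-sup estimate says that only the zero multiplier
      annihilates all \<open>v\<close>.\<close>
    then have "\<alpha>\<^sub>b * norm (\<mu> - l t) \<le> 0" by (intro inf_sup_bilinear_norm_le[OF b]) auto
    moreover have "\<alpha>\<^sub>b > 0" using b by (simp add: inf_sup_bilinear_def)
    ultimately have "\<mu> = l t" by (simp add: mult_le_0_iff)
    with \<mu> \<phi> q show "\<exists>q. strict_mono q \<and> (\<lambda>k. \<phi> (l\<^sub>n (r (q k)) t)) \<longlonglongrightarrow> \<phi> (l t)"
      unfolding weakly_converges_def by blast
  qed
  with u_lim show "(\<lambda>n. u\<^sub>n n t) \<longlonglongrightarrow> u t \<and> weakly_converges (\<lambda>n. l\<^sub>n n t) (l t)" by blast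
qed

end
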